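(* Let $(A,L_A)$ and $(B,L_B)$ be compact quantum metric spaces. Then $$\mathrm{dist}_{\mathrm{q}}(A,B)=\inf\{\mathrm{dist}_{\mathrm{H}}^V(h_A(S(A)),h_B(S(B)))\},$$ where the infimum is over all affine isometric embeddings $h_A$ and $h_B$ of $S(A)$ (with the metric $\rho_{L_A}$) and $S(B)$ (with the metric $\rho_{L_B}$) into some real normed space $V$.
   Context: An order-unit space is a real partially ordered vector space $A$ with a distinguished element $e=e_A$ (the order unit) such that (i) for each $a\in A$ there is $r\in\mathbb{R}$ with $a\le re$; (ii) if $a\le re$ for all real $r>0$ then $a\le 0$. Its norm is $\|a\|=\inf\{r\in\mathbb{R}:-re\le a\le re\}$. A state is a $\mu$ in the dual $A'$ with $\mu(e)=\|\mu\|'=1$; $S(A)$ is the (nonempty) set of states with the weak-$*$ topology. For a seminorm $L$ on $A$ put $\rho_L(\mu,\nu)=\sup\{|\mu(a)-\nu(a)|:a\in A,\ L(a)\le1\}$. $L$ is a Lip-norm, and $(A,L)$ is a compact quantum metric space, if (1) $L(a)=0$ if and only if $a\in\mathbb{R}e$; (2) the topology on $S(A)$ induced by $\rho_L$ is the weak-$*$ topology. $\mathrm{dist}_{\mathrm{H}}$ is the Hausdorff distance between nonempty subsets of a metric space. Rieffel's distance: $A\oplus B$ with order unit $(e_A,e_B)$ and the natural order is an order-unit space; via the coordinate projections, $S(A)$ and $S(B)$ are regarded as subsets of $S(A\oplus B)$. A Lip-norm $L$ on $A\oplus B$ is admissible if its quotient seminorms on $A$ and $B$ under the coordinate projections are $L_A$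 and $L_B$. Then $\mathrm{dist}_{\mathrm{q}}(A,B)=\inf\{\mathrm{dist}_{\mathrm{H}}^{\rho_L}(S(A),S(B)):L\text{ an admissible Lip-norm on }A\oplus B\}$. *)

theory Defs
  imports "HOL-Analysis.Analysis"
begin

text \<open>
  The order on a product type is the coordinatewise one of \<^theory>\<open>HOL-Library.Product_Order\<close>.
\<close>

instance prod :: (ordered_ab_semigroup_add, ordered_ab_semigroup_add) ordered_ab_semigroup_add
  by standard (auto simp: less_eq_prod_def intro: add_left_mono)

instance prod :: (ordered_cancel_ab_semigroup_add, ordered_cancel_ab_semigroup_add)
  ordered_cancel_ab_semigroup_add ..

instance prod :: (ordered_comm_monoid_add, ordered_comm_monoid_add) ordered_comm_monoid_add ..

instance prod :: (ordered_cancel_comm_monoid_add, ordered_cancel_comm_monoid_add)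
  ordered_cancel_comm_monoid_add ..

instance prod :: (ordered_ab_semigroup_add_imp_le, ordered_ab_semigroup_add_imp_le)
  ordered_ab_semigroup_add_imp_le
  by standard (auto simp: less_eq_prod_def)

instance prod :: (ordered_ab_semigroup_monoid_add_imp_le, ordered_ab_semigroup_monoid_add_imp_le)
  ordered_ab_semigroup_monoid_add_imp_le ..

instance prod :: (ordered_ab_group_add, ordered_ab_group_add) ordered_ab_group_add ..

instance prod :: (ordered_real_vector, ordered_real_vector) ordered_real_vector
  by standard (auto simp: less_eq_prod_def intro: scaleR_left_mono scaleR_right_mono)

text \<open>
  The order unit is a positive, nonzero element. The two remaining axioms do not imply this: they
  also hold for \<open>e = 0\<close> in the zero space, which has no states, and for \<open>e = - 1\<close> in \<open>\<real>\<close>, where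
  the expression below does not define a norm.
\<close>

definition order_unit_space :: "'a::ordered_real_vector \<Rightarrow> bool" where
  "order_unit_space e \<longleftrightarrow>
     0 < e \<and>
     (\<forall>a. \<exists>r::real. a \<le> r *\<^sub>R e) \<and>
     (\<forall>a. (\<forall>r::real. 0 < r \<longrightarrow> a \<le> r *\<^sub>R e) \<longrightarrow> a \<le> 0)"

definition ou_norm :: "'a::ordered_real_vector \<Rightarrow> 'a \<Rightarrow> real" where
  "ou_norm e a = Inf {r. - (r *\<^sub>R e) \<le> a \<and> a \<le> r *\<^sub>R e}"

definition ou_dual :: "'a::ordered_real_vector \<Rightarrow> ('a \<Rightarrow> real) set" where
  "ou_dual e = {f. linear f \<and> (\<exists>K. \<forall>a. \<bar>f a\<bar> \<le> K * ou_norm e a)}"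

definition dual_norm :: "'a::ordered_real_vector \<Rightarrow> ('a \<Rightarrow> real) \<Rightarrow> real" where
  "dual_norm e f = (SUP a\<in>{a. ou_norm e a \<le> 1}. \<bar>f a\<bar>)"

definition states :: "'a::ordered_real_vector \<Rightarrow> ('a \<Rightarrow> real) set" where
  "states e = {\<mu> \<in> ou_dual e. \<mu> e = 1 \<and> dual_norm e \<mu> = 1}"

definition weak_star_states :: "'a::ordered_real_vector \<Rightarrow> ('a \<Rightarrow> real) topology" where
  "weak_star_states e = subtopology (powertop_real UNIV) (states e)"

definition seminorm :: "('a::real_vector \<Rightarrow> real) \<Rightarrow> bool" where
  "seminorm L \<longleftrightarrow>
     (\<forall>a. 0 \<le> L a) \<and> (\<forall>r a. L (r *\<^sub>R a) = \<bar>r\<bar> * L a) \<and> (\<forall>a b. L (a + b) \<le> L a + L b)"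

text \<open>For an arbitrary seminorm the supremum may be infinite, hence the extended values.\<close>

definition rho :: "('a \<Rightarrow> real) \<Rightarrow> ('a \<Rightarrow> real) \<Rightarrow> ('a \<Rightarrow> real) \<Rightarrow> ennreal" where
  "rho L \<mu> \<nu> = (SUP a\<in>{a. L a \<le> 1}. ennreal \<bar>\<mu> a - \<nu> a\<bar>)"

definition ext_metric_topology :: "'x set \<Rightarrow> ('x \<Rightarrow> 'x \<Rightarrow> ennreal) \<Rightarrow> 'x topology" where
  "ext_metric_topology S d =
     topology (\<lambda>U. U \<subseteq> S \<and> (\<forall>x\<in>U. \<exists>\<epsilon>>0. \<forall>y\<in>S. d x y < \<epsilon> \<longrightarrow> y \<in> U))"

lemma openin_ext_metric_topology:
  "openin (ext_metric_topology S d) U \<longleftrightarrow>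
     U \<subseteq> S \<and> (\<forall>x\<in>U. \<exists>\<epsilon>>0. \<forall>y\<in>S. d x y < \<epsilon> \<longrightarrow> y \<in> U)"
proof -
  let ?P = "\<lambda>U. U \<subseteq> S \<and> (\<forall>x\<in>U. \<exists>\<epsilon>>0. \<forall>y\<in>S. d x y < \<epsilon> \<longrightarrow> y \<in> U)"
  have "?P (U \<inter> V)" if U: "?P U" and V: "?P V" for U V
  proof (intro conjI ballI)
    fix x assume x: "x \<in> U \<inter> V"
    obtain \<delta> \<epsilon> where "\<delta> > 0" "\<forall>y\<in>S. d x y < \<delta> \<longrightarrow> y \<in> U"
      and "\<epsilon> > 0" "\<forall>y\<in>S. d x y < \<epsilon> \<longrightarrow> y \<in> V"
      using U V x by blast
    then show "\<exists>\<epsilon>>0. \<forall>y\<in>S. d x y < \<epsilon> \<longrightarrow> y \<in> U \<inter> V"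
      by (intro exI[of _ "min \<delta> \<epsilon>"]) auto
  qed (use U in auto)
  moreover have "?P (\<Union>\<U>)" if "\<forall>U\<in>\<U>. ?P U" for \<U>
    using that by (meson Union_iff Union_least)
  ultimately have "istopology ?P"
    unfolding istopology_def by blast
  then show ?thesis
    by (simp add: ext_metric_topology_def)
qed

definition lip_norm :: "'a::ordered_real_vector \<Rightarrow> ('a \<Rightarrow> real) \<Rightarrow> bool" where
  "lip_norm e L \<longleftrightarrow>
     seminorm L \<and>
     (\<forall>a. L a = 0 \<longleftrightarrow> a \<in> range (\<lambda>r::real. r *\<^sub>R e)) \<and>
     ext_metric_topology (states e) (rho L) = weak_star_states e"

definition compact_quantum_metric_space :: "'a::ordered_real_vector \<Rightarrow> ('a \<Rightarrow> real) \<Rightarrow> bool" where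
  "compact_quantum_metric_space e L \<longleftrightarrow> order_unit_space e \<and> lip_norm e L"

definition hausdorff_dist :: "('x \<Rightarrow> 'x \<Rightarrow> ennreal) \<Rightarrow> 'x set \<Rightarrow> 'x set \<Rightarrow> ennreal" where
  "hausdorff_dist d X Y = max (SUP x\<in>X. INF y\<in>Y. d x y) (SUP y\<in>Y. INF x\<in>X. d x y)"

definition quotient_seminorm :: "('c \<Rightarrow> 'a) \<Rightarrow> ('c \<Rightarrow> real) \<Rightarrow> 'a \<Rightarrow> real" where
  "quotient_seminorm p L a = Inf {L c |c. p c = a}"

definition admissible ::
  "'a::ordered_real_vector \<Rightarrow> ('a \<Rightarrow> real) \<Rightarrow> 'b::ordered_real_vector \<Rightarrow> ('b \<Rightarrow> real) \<Rightarrow>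
   ('a \<times> 'b \<Rightarrow> real) \<Rightarrow> bool" where
  "admissible eA LA eB LB L \<longleftrightarrow>
     lip_norm (eA, eB) L \<and> quotient_seminorm fst L = LA \<and> quotient_seminorm snd L = LB"

text \<open>A state \<open>\<mu>\<close> of a summand is the state \<open>\<mu> \<circ> fst\<close>, respectively \<open>\<mu> \<circ> snd\<close>, of the sum.\<close>

definition dist_q ::
  "'a::ordered_real_vector \<Rightarrow> ('a \<Rightarrow> real) \<Rightarrow> 'b::ordered_real_vector \<Rightarrow> ('b \<Rightarrow> real) \<Rightarrow> ennreal"
where
  "dist_q eA LA eB LB =
     Inf {hausdorff_dist (rho L) ((\<lambda>\<mu>. \<mu> \<circ> fst) ` states eA) ((\<lambda>\<nu>. \<nu> \<circ> snd) ` states eB) |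
          L. admissible eA LA eB LB L}"

text \<open>
  Normed spaces are taken with explicit carrier and operations, so that one can quantify over them
  inside a formula.
\<close>

record 'v nspace =
  points :: "'v set"
  zerov :: 'v
  addv :: "'v \<Rightarrow> 'v \<Rightarrow> 'v"
  scalev :: "real \<Rightarrow> 'v \<Rightarrow> 'v"
  normv :: "'v \<Rightarrow> real"

locale real_normed_space =
  fixes V :: "'v nspace"
  assumes zero_closed: "zerov V \<in> points V"
    and add_closed: "\<lbrakk>x \<in> points V; y \<in> points V\<rbrakk> \<Longrightarrow> addv V x y \<in> points V"
    and scale_closed: "x \<in> points V \<Longrightarrow> scalev V r x \<in> points V"
    and add_assoc: "\<lbrakk>x \<in> points V; y \<in> points V; z \<in> points V\<rbrakk> \<Longrightarrow>
      addv V (addv V x y) z = addv V x (addv V y z)"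
    and add_commute: "\<lbrakk>x \<in> points V; y \<in> points V\<rbrakk> \<Longrightarrow> addv V x y = addv V y x"
    and add_zero: "x \<in> points V \<Longrightarrow> addv V (zerov V) x = x"
    and add_inverse: "x \<in> points V \<Longrightarrow> \<exists>y\<in>points V. addv V y x = zerov V"
    and scale_add_right: "\<lbrakk>x \<in> points V; y \<in> points V\<rbrakk> \<Longrightarrow>
      scalev V r (addv V x y) = addv V (scalev V r x) (scalev V r y)"
    and scale_add_left: "x \<in> points V \<Longrightarrow>
      scalev V (r + s) x = addv V (scalev V r x) (scalev V s x)"
    and scale_scale: "x \<in> points V \<Longrightarrow> scalev V r (scalev V s x) = scalev V (r * s) x"
    and scale_one: "x \<in> points V \<Longrightarrow> scalev V 1 x = x"
    and norm_nonneg: "x \<in> points V \<Longrightarrow> 0 \<le> normv V x"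
    and norm_eq_zero: "x \<in> points V \<Longrightarrow> normv V x = 0 \<longleftrightarrow> x = zerov V"
    and norm_triangle: "\<lbrakk>x \<in> points V; y \<in> points V\<rbrakk> \<Longrightarrow>
      normv V (addv V x y) \<le> normv V x + normv V y"
    and norm_scale: "x \<in> points V \<Longrightarrow> normv V (scalev V r x) = \<bar>r\<bar> * normv V x"

definition distv :: "'v nspace \<Rightarrow> 'v \<Rightarrow> 'v \<Rightarrow> ennreal" where
  "distv V x y = ennreal (normv V (addv V x (scalev V (- 1) y)))"

definition affine_isometric_embedding ::
  "'a::ordered_real_vector \<Rightarrow> ('a \<Rightarrow> real) \<Rightarrow> 'v nspace \<Rightarrow> (('a \<Rightarrow> real) \<Rightarrow> 'v) \<Rightarrow> bool" where
  "affine_isometric_embedding e L V h \<longleftrightarrow>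
     h ` states e \<subseteq> points V \<and>
     (\<forall>\<mu>\<in>states e. \<forall>\<nu>\<in>states e. \<forall>t\<in>{0..1}.
        h (\<lambda>a. (1 - t) * \<mu> a + t * \<nu> a) = addv V (scalev V (1 - t) (h \<mu>)) (scalev V t (h \<nu>))) \<and>
     (\<forall>\<mu>\<in>states e. \<forall>\<nu>\<in>states e. distv V (h \<mu>) (h \<nu>) = rho L \<mu> \<nu>)"

text \<open>
  \<open>V\<close> ranges over all real normed spaces whose underlying set is a subset of the type
  \<open>'v + ('a \<times> 'b \<Rightarrow> real)\<close>. Since \<open>'v\<close> is an arbitrary type, every given normed space occurs
  (up to renaming of its elements) for a suitable \<open>'v\<close>. The second summand guarantees that the type
  is never too small: it has at least the cardinality of the linear span of any images of the two
  state spaces, and passing to that span does not affect the Hausdorff distance.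
\<close>

definition embedding_dists ::
  "'v itself \<Rightarrow> 'a::ordered_real_vector \<Rightarrow> ('a \<Rightarrow> real) \<Rightarrow>
   'b::ordered_real_vector \<Rightarrow> ('b \<Rightarrow> real) \<Rightarrow> ennreal set" where
  "embedding_dists _ eA LA eB LB =
     {hausdorff_dist (distv V) (hA ` states eA) (hB ` states eB) |
        (V :: ('v + ('a \<times> 'b \<Rightarrow> real)) nspace) hA hB.
        real_normed_space V \<and>
        affine_isometric_embedding eA LA V hA \<and>
        affine_isometric_embedding eB LB V hB}"

end

theory Submission
  imports Defs
begin

text \<open>
  An admissible Lip-norm \<open>L\<close> on the sum gives embeddings into one normed space. Let \<open>V\<close> be the space
  of linear functionals that are bounded on the unit ball of \<open>L\<close>, with the dual norm. Subtracting a
  fixed base state sends the states of the sum affinely into \<open>V\<close>, and \<open>\<rho>\<^sub>L\<close> becomes the norm distance,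
  because \<open>\<rho>\<^sub>L\<close> is finite on states. The states of a summand are embedded isometrically for the
  original metric since the Lip-norm of the summand is the quotient of \<open>L\<close>
  (\<open>affine_isometric_embedding_quotient\<close>). So the Hausdorff distances agree.

  Conversely, let the state spaces be embedded by \<open>h\<^sub>A\<close> and \<open>h\<^sub>B\<close> into \<open>V\<close>, and put
  \<open>N \<mu> \<nu> = \<parallel>h\<^sub>A \<mu> - h\<^sub>B \<nu>\<parallel>\<close>. For \<open>\<epsilon> > 0\<close> consider on the sum the seminorm
  \<open>max (LA a) (LB b) (sup \<bar>\<mu> a - \<nu> b\<bar> / (N \<mu> \<nu> + \<epsilon>))\<close>, the supremum being over all states. Its
  \<open>\<rho>\<close> is at most \<open>N \<mu> \<nu> + \<epsilon>\<close> between \<open>\<mu>\<close> and \<open>\<nu>\<close>, so the Hausdorff distance grows by at most \<open>\<epsilon>\<close>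
  (\<open>dist_q_le_bridge\<close>). It must be shown to be an admissible Lip-norm.

  It is a Lip-norm because a state of the sum is a convex combination of a state of each summand,
  and on each summand weak-* closeness implies closeness for \<open>\<rho>\<close> (\<open>lip_norm_bridge_norm\<close>).

  Its quotients are \<open>LA\<close> and \<open>LB\<close> because each \<open>a\<close> with \<open>LA a \<le> 1\<close> has a partner \<open>b\<close> with \<open>LB b \<le> 1\<close> and
  \<open>\<bar>\<mu> a - \<nu> b\<bar> \<le> N \<mu> \<nu> + \<epsilon>\<close> for all states (\<open>bridge_partner\<close>). This is the heart of the proof. One
  way is to extend the function \<open>a\<close> from the image of its state space to a contraction on \<open>V\<close>, restrict
  it to the image of the other one, and approximate the result by elements of the second space.
  Here the two steps are replaced by one minimax argument: for four given states a
  suitable \<open>b\<close> exists by the triangle inequality in \<open>V\<close>, the defect is concave in the states and affine in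
  \<open>b\<close>, and compactness of the state spaces gives a partner for all states at once.

  The state spaces are compact by Tychonoff's theorem and nonempty by the Hahn-Banach theorem.
\<close>

section \<open>Dominated linear functionals\<close>

definition sublinear :: "('a::real_vector \<Rightarrow> real) \<Rightarrow> bool" where
  "sublinear p \<longleftrightarrow>
     (\<forall>x y. p (x + y) \<le> p x + p y) \<and> (\<forall>t\<ge>0. \<forall>x. p (t *\<^sub>R x) \<le> t * p x)"

lemma sublinear_zero:
  assumes "sublinear p"
  shows "p 0 = 0"
proof -
  have "p (0 + 0) \<le> p 0 + p 0" and "p (0 *\<^sub>R 0) \<le> 0 * p 0"
    using assms unfolding sublinear_def by blast+
  then show ?thesis by simp
qed

lemma sublinear_ge_neg:
  assumes "sublinear p"
  shows "- p (- x) \<le> p x"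
proof -
  have "p (x + - x) \<le> p x + p (- x)"
    using assms unfolding sublinear_def by blast
  then show ?thesis by (simp add: sublinear_zero[OF assms])
qed

text \<open>
  If \<open>m\<close> is minimal among sublinear functionals, then lowering it as far as possible in the
  direction \<open>y\<close> changes nothing, and this says that \<open>m\<close> is also superadditive.
\<close>

lemma minimal_sublinear_linear:
  fixes m :: "'a::real_vector \<Rightarrow> real"
  assumes m: "sublinear m"
    and min: "\<And>q. sublinear q \<Longrightarrow> (\<And>x. q x \<le> m x) \<Longrightarrow> q = m"
  shows "linear m"
proof -
  have sub: "m (x + y) \<le> m x + m y" and hom: "t \<ge> 0 \<Longrightarrow> m (t *\<^sub>R x) \<le> t * m x" for x y t
    using m unfolding sublinear_def by blast+
  have m0: "m 0 = 0" by (rule sublinear_zero[OF m])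
  have super: "m x + m y \<le> m (x + y)" for x y
  proof -
    define q where "q = (\<lambda>x. INF t\<in>{0..}. m (x + t *\<^sub>R y) - t * m y)"
    have hom_eq: "m (t *\<^sub>R y) = t * m y" if "t \<ge> 0" for t
    proof (cases "t = 0")
      case False
      then have "m (inverse t *\<^sub>R (t *\<^sub>R y)) \<le> inverse t * m (t *\<^sub>R y)"
        using that by (intro hom) auto
      then have "t * m y \<le> m (t *\<^sub>R y)"
        using False that by (simp add: field_simps)
      then show ?thesis using hom[OF that, of y] by simp
    qed (simp add: m0)
    have lower: "- m (- x) \<le> m (x + t *\<^sub>R y) - t * m y" if "t \<ge> 0" for x t
      using sub[of "x + t *\<^sub>R y" "- x"] hom_eq[OF that] by simp
    have bdd: "bdd_below ((\<lambda>t. m (x + t *\<^sub>R y) - t * m y) ` {0..})" for x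
      using lower[of _ x] by (auto intro!: bdd_belowI)
    have q_le: "q x \<le> m (x + t *\<^sub>R y) - t * m y" if "t \<ge> 0" for x t
      unfolding q_def using that by (intro cINF_lower bdd) auto
    have q_ge: "c \<le> q x" if "\<And>t. t \<ge> 0 \<Longrightarrow> c \<le> m (x + t *\<^sub>R y) - t * m y" for x c
      unfolding q_def using that by (intro cINF_greatest) auto
    have "q (x + x') \<le> q x + q x'" for x x'
    proof -
      have "q (x + x') - (m (x' + t' *\<^sub>R y) - t' * m y) \<le> q x" if t': "t' \<ge> 0" for t'
      proof (rule q_ge)
        fix t :: real assume "t \<ge> 0"
        then have "q (x + x') \<le> m (x + x' + (t + t') *\<^sub>R y) - (t + t') * m y"
          using t' by (intro q_le) simp
        also have "x + x' + (t + t') *\<^sub>R y = (x + t *\<^sub>R y) + (x' + t' *\<^sub>R y)"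
          by (simp add: algebra_simps)
        also have "m \<dots> \<le> m (x + t *\<^sub>R y) + m (x' + t' *\<^sub>R y)" by (rule sub)
        finally show "q (x + x') - (m (x' + t' *\<^sub>R y) - t' * m y) \<le> m (x + t *\<^sub>R y) - t * m y"
          by (simp add: algebra_simps)
      qed
      then have "q (x + x') - q x \<le> q x'"
        by (intro q_ge) (simp add: algebra_simps)
      then show ?thesis by simp
    qed
    moreover have "q (s *\<^sub>R x) \<le> s * q x" if "s \<ge> 0" for s x
    proof (cases "s = 0")
      case True
      then show ?thesis using q_le[of 0 0] by (simp add: m0)
    next
      case False
      with that have s: "s > 0" by simp
      have "q (s *\<^sub>R x) / s \<le> q x"
      proof (rule q_ge)
        fix t :: real assume t: "t \<ge> 0"
        have "q (s *\<^sub>R x) \<le> m (s *\<^sub>R x + (s * t) *\<^sub>R y) - (s * t) * m y"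
          using s t by (intro q_le) simp
        also have "s *\<^sub>R x + (s * t) *\<^sub>R y = s *\<^sub>R (x + t *\<^sub>R y)"
          by (simp add: algebra_simps)
        also have "m \<dots> \<le> s * m (x + t *\<^sub>R y)" using s by (intro hom) simp
        finally show "q (s *\<^sub>R x) / s \<le> m (x + t *\<^sub>R y) - t * m y"
          using s by (simp add: field_simps)
      qed
      then show ?thesis using s by (simp add: field_simps)
    qed
    ultimately have "sublinear q" unfolding sublinear_def by blast
    moreover have "q x \<le> m x" for x using q_le[of 0 x] by simp
    ultimately have "q = m" by (rule min)
    then show ?thesis using q_le[of 1 x] by simp
  qed
  have add: "m (x + y) = m x + m y" for x y
    using sub[of x y] super[of x y] by simp
  have neg: "m (- x) = - m x" for x
    using add[of x "- x"] m0 by simp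
  have pos: "m (t *\<^sub>R x) = t * m x" if "t \<ge> 0" for t x
    using hom[OF that, of x] hom[OF that, of "- x"] neg by simp
  have "m (t *\<^sub>R x) = t * m x" for t x
    using pos[of t x] pos[of "- t" x] neg[of "t *\<^sub>R x"] by (cases "t \<ge> 0") auto
  with add show "linear m" by (intro linearI) auto
qed

text \<open>
  The Hahn-Banach theorem in the form that yields states. Zorn's lemma gives a minimal sublinear
  functional below \<open>p\<close>: a chain has its pointwise infimum as a lower bound, which is finite
  because \<open>q x \<ge> - q (- x) \<ge> - p (- x)\<close> for all \<open>q\<close> in the chain.
\<close>

lemma dominated_linear_exists:
  fixes p :: "'a::real_vector \<Rightarrow> real"
  assumes p: "sublinear p"
  shows "\<exists>f. linear f \<and> (\<forall>x. f x \<le> p x)"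
proof -
  define A where "A = {q. sublinear q \<and> (\<forall>x. q x \<le> p x)}"
  define P where "P = (\<lambda>(q::'a \<Rightarrow> real) r. \<forall>x. r x \<le> q x)"
  have "\<exists>m\<in>A. \<forall>q\<in>A. P m q \<longrightarrow> q = m"
  proof (rule predicate_Zorn)
    show "partial_order_on A (relation_of P A)"
      by (intro partial_order_on_relation_ofI)
        (auto simp: P_def intro: order_trans intro!: ext order_antisym)
  next
    fix C assume C: "C \<in> Chains (relation_of P A)"
    then have CA: "C \<subseteq> A" by (auto simp: Chains_def relation_of_def)
    have chain: "P q r \<or> P r q" if "q \<in> C" "r \<in> C" for q r
      using C that by (auto simp: Chains_def relation_of_def)
    show "\<exists>u\<in>A. \<forall>q\<in>C. P q u"
    proof (cases "C = {}")
      case True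
      then show ?thesis using p by (auto simp: A_def)
    next
      case False
      define u where "u = (\<lambda>x. INF q\<in>C. q x)"
      have sub: "q (x + y) \<le> q x + q y" and hom: "t \<ge> 0 \<Longrightarrow> q (t *\<^sub>R x) \<le> t * q x"
        and le_p: "q x \<le> p x" if "q \<in> C" for q x y t
        using that CA unfolding A_def sublinear_def by auto
      have "- p (- x) \<le> q x" if "q \<in> C" for q x
        using sublinear_ge_neg[of q x] le_p[OF that, of "- x"] that CA by (force simp: A_def)
      then have bdd: "bdd_below ((\<lambda>q. q x) ` C)" for x
        by (auto intro!: bdd_belowI)
      have u_le: "u x \<le> q x" if "q \<in> C" for q x
        unfolding u_def using that by (intro cINF_lower bdd)
      have u_ge: "c \<le> u x" if "\<And>q. q \<in> C \<Longrightarrow> c \<le> q x" for c x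
        unfolding u_def using that False by (intro cINF_greatest) auto
      have "u (x + y) \<le> u x + u y" for x y
      proof -
        have "u (x + y) - r y \<le> u x" if r: "r \<in> C" for r
        proof (rule u_ge)
          fix q assume q: "q \<in> C"
          \<comment> \<open>Evaluate at the smaller of the two functionals.\<close>
          have "u (x + y) \<le> q x + r y"
          proof (cases "P q r")
            case True
            then have "r x \<le> q x" by (simp add: P_def)
            then show ?thesis using sub[OF r, of x y] u_le[OF r, of "x + y"] by linarith
          next
            case False
            then have "P r q" using chain[OF q r] by blast
            then have "q y \<le> r y" by (simp add: P_def)
            then show ?thesis using sub[OF q, of x y] u_le[OF q, of "x + y"] by linarith
          qed
          then show "u (x + y) - r y \<le> q x" by simp
        qed
        then have "u (x + y) - u x \<le> u y"
          by (intro u_ge) (simp add: algebra_simps)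
        then show ?thesis by simp
      qed
      moreover have "u (t *\<^sub>R x) \<le> t * u x" if t: "t \<ge> 0" for t x
      proof (cases "t = 0")
        case True
        obtain q where "q \<in> C" using False by blast
        then show ?thesis
          using u_le[of q 0] hom[of q 0 0] True by simp
      next
        case False
        with t have t: "t > 0" by simp
        have "u (t *\<^sub>R x) / t \<le> u x"
        proof (rule u_ge)
          fix q assume "q \<in> C"
          then show "u (t *\<^sub>R x) / t \<le> q x"
            using u_le[of q "t *\<^sub>R x"] hom[of q t x] t by (simp add: field_simps)
        qed
        then show ?thesis using t by (simp add: field_simps)
      qed
      moreover have "u x \<le> p x" for x
        using False u_le le_p by (meson all_not_in_conv order_trans)
      ultimately have "u \<in> A" by (auto simp: A_def sublinear_def)
      then show ?thesis using u_le by (auto simp: P_def)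
    qed
  qed
  then obtain m where m: "m \<in> A" and min: "\<And>q. q \<in> A \<Longrightarrow> P m q \<Longrightarrow> q = m" by blast
  have "linear m"
  proof (rule minimal_sublinear_linear)
    show "sublinear m" using m by (simp add: A_def)
    fix q assume q: "sublinear q" "\<And>x. q x \<le> m x"
    then have "q \<in> A" using m by (auto simp: A_def intro: order_trans)
    then show "q = m" using q by (intro min) (auto simp: P_def)
  qed
  then show ?thesis using m by (auto simp: A_def)
qed

section \<open>Order-unit spaces and their states\<close>

lemma order_unit_pos: "order_unit_space e \<Longrightarrow> 0 < e"
  by (simp add: order_unit_space_def)

lemma scale_unit_le_iff:
  assumes "order_unit_space e"
  shows "r *\<^sub>R e \<le> s *\<^sub>R e \<longleftrightarrow> r \<le> s"
proof
  assume le: "r *\<^sub>R e \<le> s *\<^sub>R e"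
  show "r \<le> s"
  proof (rule ccontr)
    assume "\<not> r \<le> s"
    then have "inverse (r - s) *\<^sub>R ((r - s) *\<^sub>R e) \<le> inverse (r - s) *\<^sub>R 0"
      using le by (intro scaleR_left_mono) (auto simp: algebra_simps)
    then show False
      using order_unit_pos[OF assms] \<open>\<not> r \<le> s\<close> by simp
  qed
next
  assume "r \<le> s"
  then show "r *\<^sub>R e \<le> s *\<^sub>R e"
    using order_unit_pos[OF assms] by (intro scaleR_right_mono) auto
qed

lemma archimedean_order_unit:
  assumes "order_unit_space e" "\<And>r. r > s \<Longrightarrow> a \<le> r *\<^sub>R e"
  shows "a \<le> s *\<^sub>R e"
proof -
  have "a - s *\<^sub>R e \<le> r *\<^sub>R e" if "r > 0" for r
    using assms(2)[of "s + r"] that by (simp add: algebra_simps)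
  then have "a - s *\<^sub>R e \<le> 0"
    using assms(1) unfolding order_unit_space_def by blast
  then show ?thesis by simp
qed

lemma order_unit_interval:
  assumes e: "order_unit_space e"
  obtains r where "- (r *\<^sub>R e) \<le> a" "a \<le> r *\<^sub>R e"
proof -
  obtain r s where r: "a \<le> r *\<^sub>R e" and s: "- a \<le> s *\<^sub>R e"
    using e unfolding order_unit_space_def by metis
  have "a \<le> max r s *\<^sub>R e"
    using r scale_unit_le_iff[OF e, of r "max r s"] by (meson max.cobounded1 order_trans)
  moreover have "- a \<le> max r s *\<^sub>R e"
    using s scale_unit_le_iff[OF e, of s "max r s"] by (meson max.cobounded2 order_trans)
  ultimately show thesis
    using that[of "max r s"] by (simp add: minus_le_iff)
qed

lemma ou_interval_nonneg:
  assumes e: "order_unit_space e" and "- (r *\<^sub>R e) \<le> a" "a \<le> r *\<^sub>R e"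
  shows "0 \<le> r"
proof -
  have "(- r) *\<^sub>R e \<le> r *\<^sub>R e" using assms(2,3) by simp
  then show ?thesis using scale_unit_le_iff[OF e, of "- r" r] by simp
qed

lemma ou_norm_le:
  assumes e: "order_unit_space e" and "- (r *\<^sub>R e) \<le> a" "a \<le> r *\<^sub>R e"
  shows "ou_norm e a \<le> r"
proof -
  have "bdd_below {r. - (r *\<^sub>R e) \<le> a \<and> a \<le> r *\<^sub>R e}"
    using ou_interval_nonneg[OF e] by (intro bdd_belowI[of _ 0]) blast
  then show ?thesis
    unfolding ou_norm_def using assms(2,3) by (intro cInf_lower) simp_all
qed

lemma ou_norm_nonneg:
  assumes e: "order_unit_space e"
  shows "0 \<le> ou_norm e a"
proof -
  obtain r where "- (r *\<^sub>R e) \<le> a" "a \<le> r *\<^sub>R e"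
    using order_unit_interval[OF e] by blast
  then show ?thesis
    unfolding ou_norm_def by (intro cInf_greatest) (auto intro: ou_interval_nonneg[OF e])
qed

text \<open>The infimum in the definition of the norm is attained, by the Archimedean axiom.\<close>

lemma
  assumes e: "order_unit_space e"
  shows le_ou_norm: "a \<le> ou_norm e a *\<^sub>R e"
    and neg_ou_norm_le: "- (ou_norm e a *\<^sub>R e) \<le> a"
proof -
  have *: "- (s *\<^sub>R e) \<le> a \<and> a \<le> s *\<^sub>R e" if "s > ou_norm e a" for s
  proof -
    obtain r0 where "- (r0 *\<^sub>R e) \<le> a" "a \<le> r0 *\<^sub>R e"
      using order_unit_interval[OF e] by blast
    then have "\<exists>r\<in>{r. - (r *\<^sub>R e) \<le> a \<and> a \<le> r *\<^sub>R e}. r < s"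
      using that by (intro cInf_lessD) (auto simp: ou_norm_def)
    then obtain r where r: "- (r *\<^sub>R e) \<le> a" "a \<le> r *\<^sub>R e" "r < s" by blast
    then have "r *\<^sub>R e \<le> s *\<^sub>R e" using scale_unit_le_iff[OF e] by simp
    with r(1,2) show ?thesis
      by (meson neg_le_iff_le order_trans)
  qed
  show "a \<le> ou_norm e a *\<^sub>R e"
    by (rule archimedean_order_unit[OF e]) (simp add: *)
  have "- a \<le> ou_norm e a *\<^sub>R e"
  proof (rule archimedean_order_unit[OF e])
    fix r assume "r > ou_norm e a"
    then show "- a \<le> r *\<^sub>R e" using *[of r] by (simp add: minus_le_iff)
  qed
  then show "- (ou_norm e a *\<^sub>R e) \<le> a" by (simp add: minus_le_iff)
qed

lemma ou_norm_scale_le: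
  assumes e: "order_unit_space e" and "t \<ge> 0"
  shows "ou_norm e (t *\<^sub>R a) \<le> t * ou_norm e a"
proof (rule ou_norm_le[OF e])
  show "t *\<^sub>R a \<le> (t * ou_norm e a) *\<^sub>R e"
    using scaleR_left_mono[OF le_ou_norm[OF e, of a] assms(2)]
    unfolding scaleR_scaleR .
  show "- ((t * ou_norm e a) *\<^sub>R e) \<le> t *\<^sub>R a"
    using scaleR_left_mono[OF neg_ou_norm_le[OF e, of a] assms(2)]
    unfolding scaleR_minus_right scaleR_scaleR .
qed

lemma positive_functional_bound:
  assumes e: "order_unit_space e" and f: "linear f" and pos: "\<And>a. a \<ge> 0 \<Longrightarrow> f a \<ge> 0"
  shows "\<bar>f a\<bar> \<le> ou_norm e a * f e"
proof -
  have "0 \<le> f (ou_norm e a *\<^sub>R e - a)" "0 \<le> f (a + ou_norm e a *\<^sub>R e)"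
    using le_ou_norm[OF e, of a] neg_ou_norm_le[OF e, of a]
    by (auto intro!: pos) (metis diff_ge_0_iff_ge diff_minus_eq_add)
  then show ?thesis
    by (simp add: linear_diff[OF f] linear_add[OF f] linear_cmul[OF f])
qed

text \<open>
  For unital functionals, having norm one is the same as being positive: if \<open>0 \<le> a\<close> and
  \<open>s \<ge> \<parallel>a\<parallel>\<close>, then \<open>\<parallel>s e - a\<parallel> \<le> s\<close>, so a functional of norm one cannot be negative at \<open>a\<close>.
\<close>

lemma states_eq_positive_unital:
  fixes e :: "'a::ordered_real_vector"
  assumes e: "order_unit_space e"
  shows "states e = {\<mu>. linear \<mu> \<and> \<mu> e = 1 \<and> (\<forall>a\<ge>0. 0 \<le> \<mu> a)}"
proof (intro equalityI subsetI CollectI)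
  fix \<mu> :: "'a \<Rightarrow> real" assume "\<mu> \<in> states e"
  then obtain K where lin: "linear \<mu>" and K: "\<And>a. \<bar>\<mu> a\<bar> \<le> K * ou_norm e a"
    and e1: "\<mu> e = 1" and n1: "dual_norm e \<mu> = 1"
    unfolding states_def ou_dual_def by auto
  have "\<bar>\<mu> a\<bar> \<le> \<bar>K\<bar>" if "ou_norm e a \<le> 1" for a
  proof -
    have "\<bar>\<mu> a\<bar> \<le> \<bar>K\<bar> * ou_norm e a"
      using K[of a] ou_norm_nonneg[OF e, of a]
      by (meson abs_ge_self mult_right_mono order_trans)
    also have "\<dots> \<le> \<bar>K\<bar> * 1" using that by (intro mult_left_mono) auto
    finally show ?thesis by simp
  qed
  then have "bdd_above ((\<lambda>a. \<bar>\<mu> a\<bar>) ` {a. ou_norm e a \<le> 1})"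
    by (auto intro!: bdd_aboveI)
  then have unit: "\<bar>\<mu> a\<bar> \<le> 1" if "ou_norm e a \<le> 1" for a
    using that n1 unfolding dual_norm_def by (metis cSUP_upper mem_Collect_eq)
  have "0 \<le> \<mu> a" if a: "a \<ge> 0" for a
  proof -
    define s where "s = ou_norm e a + 1"
    have s: "s > 0" using ou_norm_nonneg[OF e, of a] by (simp add: s_def)
    have "a \<le> s *\<^sub>R e"
      using le_ou_norm[OF e, of a] scale_unit_le_iff[OF e, of "ou_norm e a" s]
      by (auto simp: s_def intro: order_trans)
    then have "0 \<le> s *\<^sub>R e - a" by simp
    moreover have "- (s *\<^sub>R e) \<le> 0"
      using s order_unit_pos[OF e] by (simp add: scaleR_nonneg_nonneg)
    ultimately have "- (s *\<^sub>R e) \<le> s *\<^sub>R e - a" by (rule order_trans[rotated])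
    then have "ou_norm e (s *\<^sub>R e - a) \<le> s"
      using a by (intro ou_norm_le[OF e]) simp_all
    then have "inverse s * ou_norm e (s *\<^sub>R e - a) \<le> 1"
      using s by (simp add: field_simps)
    then have "ou_norm e (inverse s *\<^sub>R (s *\<^sub>R e - a)) \<le> 1"
      using ou_norm_scale_le[OF e, of "inverse s" "s *\<^sub>R e - a"] s by simp
    then have "\<bar>\<mu> (inverse s *\<^sub>R (s *\<^sub>R e - a))\<bar> \<le> 1" by (rule unit)
    then show ?thesis
      using s by (simp add: linear_diff[OF lin] linear_cmul[OF lin] e1 field_simps)
  qed
  with lin e1 show "linear \<mu> \<and> \<mu> e = 1 \<and> (\<forall>a\<ge>0. 0 \<le> \<mu> a)" by blast
next
  fix \<mu> :: "'a \<Rightarrow> real" assume "\<mu> \<in> {\<mu>. linear \<mu> \<and> \<mu> e = 1 \<and> (\<forall>a\<ge>0. 0 \<le> \<mu> a)}"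
  then have lin: "linear \<mu>" and e1: "\<mu> e = 1" and pos: "\<And>a. a \<ge> 0 \<Longrightarrow> 0 \<le> \<mu> a" by auto
  have bound: "\<bar>\<mu> a\<bar> \<le> ou_norm e a" for a
    using positive_functional_bound[OF e lin pos, of a] e1 by simp
  have "- e \<le> 0" "0 \<le> e"
    using order_unit_pos[OF e] by simp_all
  then have "- e \<le> e" by (rule order_trans)
  then have "ou_norm e e \<le> 1" by (intro ou_norm_le[OF e]) simp_all
  then have "dual_norm e \<mu> = 1"
    unfolding dual_norm_def
    by (intro cSup_eq_maximum) (auto simp: e1 image_iff intro: order_trans[OF bound] intro!: exI[of _ e])
  moreover have "\<mu> \<in> ou_dual e"
    unfolding ou_dual_def using lin bound by (auto intro!: exI[of _ 1])
  ultimately show "\<mu> \<in> states e" by (simp add: states_def e1)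
qed

context
  fixes e :: "'a::ordered_real_vector"
  assumes e: "order_unit_space e"
begin

lemma stateI:
  assumes "linear \<mu>" "\<mu> e = 1" "\<And>a. a \<ge> 0 \<Longrightarrow> 0 \<le> \<mu> a"
  shows "\<mu> \<in> states e"
  using assms by (simp add: states_eq_positive_unital[OF e])

lemma state_linear: "\<mu> \<in> states e \<Longrightarrow> linear \<mu>"
  and state_unit: "\<mu> \<in> states e \<Longrightarrow> \<mu> e = 1"
  and state_nonneg: "\<mu> \<in> states e \<Longrightarrow> a \<ge> 0 \<Longrightarrow> 0 \<le> \<mu> a"
  by (simp_all add: states_eq_positive_unital[OF e])

lemma state_scale_unit: "\<mu> \<in> states e \<Longrightarrow> \<mu> (r *\<^sub>R e) = r"
  by (simp add: linear_cmul[OF state_linear] state_unit)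

lemma state_bound: "\<mu> \<in> states e \<Longrightarrow> \<bar>\<mu> a\<bar> \<le> ou_norm e a"
  using positive_functional_bound[OF e state_linear, of \<mu> a] state_nonneg state_unit by force

lemma states_convex:
  assumes \<mu>: "\<mu> \<in> states e" and \<nu>: "\<nu> \<in> states e" and t: "t \<in> {0..1}"
  shows "(\<lambda>a. (1 - t) * \<mu> a + t * \<nu> a) \<in> states e"
proof (rule stateI)
  show "linear (\<lambda>a. (1 - t) * \<mu> a + t * \<nu> a)"
    using state_linear[OF \<mu>] state_linear[OF \<nu>]
    by (intro linearI) (simp_all add: linear_add linear_cmul algebra_simps)
qed (use t in \<open>auto simp: state_unit[OF \<mu>] state_unit[OF \<nu>] state_nonneg[OF \<mu>] state_nonneg[OF \<nu>]\<close>)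

lemma positive_functional_multiple_of_state:
  assumes f: "linear f" and pos: "\<And>a. a \<ge> 0 \<Longrightarrow> 0 \<le> f a" and ne: "states e \<noteq> {}"
  obtains \<mu> where "\<mu> \<in> states e" "\<And>a. f a = f e * \<mu> a"
proof (cases "f e = 0")
  case True
  then have "f a = 0" for a
    using positive_functional_bound[OF e f pos, of a] by simp
  moreover obtain \<mu> where "\<mu> \<in> states e" using ne by blast
  ultimately show thesis using that True by simp
next
  case False
  then have "f e > 0" using pos[of e] order_unit_pos[OF e] by (simp add: order_less_le)
  then have "(\<lambda>a. f a / f e) \<in> states e"
    by (intro stateI linearI) (auto simp: linear_add[OF f] linear_cmul[OF f] add_divide_distrib pos)
  then show thesis using that \<open>f e > 0\<close> by fastforce
qed

text \<open>
  The states are exactly the linear functionals below the sublinear functional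
  \<open>a \<mapsto> inf {r. a \<le> r e}\<close>.
\<close>

lemma states_nonempty: "states e \<noteq> {}"
proof -
  define p where "p = (\<lambda>a. Inf {r. a \<le> r *\<^sub>R e})"
  have lower: "- ou_norm e a \<le> r" if "a \<le> r *\<^sub>R e" for a r
    using order_trans[OF neg_ou_norm_le[OF e, of a] that] scale_unit_le_iff[OF e, of "- ou_norm e a" r]
    by simp
  have bdd: "bdd_below {r. a \<le> r *\<^sub>R e}" for a
    using lower[of a] by (auto intro!: bdd_belowI)
  have p_le: "p a \<le> r" if "a \<le> r *\<^sub>R e" for a r
    unfolding p_def using that by (intro cInf_lower bdd) simp
  have le_p: "c \<le> p a" if "\<And>r. a \<le> r *\<^sub>R e \<Longrightarrow> c \<le> r" for a c
    unfolding p_def using that le_ou_norm[OF e, of a] by (intro cInf_greatest) auto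
  have attained: "a \<le> p a *\<^sub>R e" for a
  proof (rule archimedean_order_unit[OF e])
    fix r assume "r > p a"
    then obtain s where "a \<le> s *\<^sub>R e" "s < r"
      using le_p[of a r] by force
    then show "a \<le> r *\<^sub>R e"
      using scale_unit_le_iff[OF e, of s r] by (auto intro: order_trans)
  qed
  have "p (a + b) \<le> p a + p b" for a b
    using add_mono[OF attained[of a] attained[of b]] by (intro p_le) (simp add: scaleR_left_distrib)
  moreover have "p (t *\<^sub>R a) \<le> t * p a" if "t \<ge> 0" for t a
    using scaleR_left_mono[OF attained[of a] that] by (intro p_le) simp
  ultimately have "sublinear p" by (auto simp: sublinear_def)
  then obtain f where f: "linear f" and le: "\<And>x. f x \<le> p x"
    using dominated_linear_exists by blast
  have "f e \<le> 1" using le[of e] p_le[of e 1] by simp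
  moreover have "f (- e) \<le> -1" using le[of "- e"] p_le[of "- e" "-1"] by simp
  ultimately have "f e = 1" by (simp add: linear_neg[OF f])
  moreover have "0 \<le> f a" if "a \<ge> 0" for a
    using le[of "- a"] p_le[of "- a" 0] that by (simp add: linear_neg[OF f])
  ultimately show ?thesis using stateI[OF f] by blast
qed

lemma weak_star_states_eq: "weak_star_states e = top_of_set (states e)"
  by (simp add: weak_star_states_def euclidean_product_topology)

text \<open>
  In the product topology the states are a closed subset of a product of compact intervals, to
  which Tychonoff's theorem applies.
\<close>

lemma compact_states: "compact (states e)"
proof -
  define K where "K = (\<Pi>\<^sub>E a\<in>UNIV. {- ou_norm e a..ou_norm e a})"
  have "compactin (powertop_real UNIV) K"
    unfolding K_def by (simp add: compactin_PiE)
  then have K: "compact K"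
    by (simp add: euclidean_product_topology)
  have coord: "continuous_on UNIV (\<lambda>\<mu>. \<mu> a)" for a :: 'a
    by (rule continuous_on_product_coordinates)
  have "closed ({\<mu>. \<forall>a b. \<mu> (a + b) = \<mu> a + \<mu> b} \<inter> {\<mu>. \<forall>t a. \<mu> (t *\<^sub>R a) = t * \<mu> a} \<inter>
      {\<mu>. \<mu> e = 1} \<inter> {\<mu>. \<forall>a. a \<ge> 0 \<longrightarrow> 0 \<le> \<mu> a})" (is "closed ?C")
    by (intro closed_Int closed_Collect_all closed_Collect_eq closed_Collect_imp
        closed_Collect_le continuous_intros coord) auto
  moreover have "states e = ?C \<inter> K"
    using state_bound
    by (auto simp: states_eq_positive_unital[OF e] linear_iff K_def PiE_iff abs_le_iff minus_le_iff)
  ultimately show ?thesis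
    using K by (simp only: closed_Int_compact)
qed

end

section \<open>Seminorms and the dual size of a functional\<close>

lemma
  assumes "seminorm L"
  shows seminorm_nonneg: "0 \<le> L a"
    and seminorm_scale: "L (r *\<^sub>R a) = \<bar>r\<bar> * L a"
    and seminorm_add: "L (a + b) \<le> L a + L b"
  using assms by (auto simp: seminorm_def)

lemma seminorm_zero: "seminorm L \<Longrightarrow> L 0 = 0"
  using seminorm_scale[of L 0 0] by simp

lemma seminorm_minus: "seminorm L \<Longrightarrow> L (- a) = L a"
  using seminorm_scale[of L "- 1" a] by simp

lemma seminorm_diff: "seminorm L \<Longrightarrow> L (a - b) \<le> L a + L b"
  using seminorm_add[of L a "- b"] by (simp add: seminorm_minus)

lemma seminorm_sum_le:
  assumes L: "seminorm L" and "finite I"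
  shows "L (\<Sum>i\<in>I. c i *\<^sub>R a i) \<le> (\<Sum>i\<in>I. \<bar>c i\<bar> * L (a i))"
  using assms(2)
proof (induction rule: finite_induct)
  case (insert i I)
  then show ?case
    using seminorm_add[OF L, of "c i *\<^sub>R a i" "\<Sum>i\<in>I. c i *\<^sub>R a i"]
    by (simp add: seminorm_scale[OF L])
qed (simp add: seminorm_zero[OF L])

definition lip_bounded :: "('a::real_vector \<Rightarrow> real) \<Rightarrow> ('a \<Rightarrow> real) \<Rightarrow> bool" where
  "lip_bounded L f \<longleftrightarrow> bdd_above ((\<lambda>a. \<bar>f a\<bar>) ` {a. L a \<le> 1})"

definition lip_dual :: "('a::real_vector \<Rightarrow> real) \<Rightarrow> ('a \<Rightarrow> real) \<Rightarrow> real" where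
  "lip_dual L f = (SUP a\<in>{a. L a \<le> 1}. \<bar>f a\<bar>)"

lemma lip_boundedI: "(\<And>a. L a \<le> 1 \<Longrightarrow> \<bar>f a\<bar> \<le> c) \<Longrightarrow> lip_bounded L f"
  unfolding lip_bounded_def by (auto intro!: bdd_aboveI)

lemma lip_dual_upper: "lip_bounded L f \<Longrightarrow> L a \<le> 1 \<Longrightarrow> \<bar>f a\<bar> \<le> lip_dual L f"
  unfolding lip_dual_def lip_bounded_def by (rule cSUP_upper) simp_all

lemma lip_dual_least:
  assumes "seminorm L" "\<And>a. L a \<le> 1 \<Longrightarrow> \<bar>f a\<bar> \<le> c"
  shows "lip_dual L f \<le> c"
  unfolding lip_dual_def
  by (rule cSUP_least) (use assms seminorm_zero[of L] in \<open>auto intro: exI[of _ 0]\<close>)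

lemma lip_dual_nonneg: "seminorm L \<Longrightarrow> lip_bounded L f \<Longrightarrow> 0 \<le> lip_dual L f"
  using lip_dual_upper[of L f 0] seminorm_zero[of L] by (simp add: order_trans[OF abs_ge_zero])

text \<open>
  A bounded functional vanishes where \<open>L\<close> does, since the kernel of \<open>L\<close> is contained in every
  positive multiple of the unit ball.
\<close>

lemma lip_dual_bound:
  assumes L: "seminorm L" and f: "linear f" and b: "lip_bounded L f"
  shows "\<bar>f a\<bar> \<le> lip_dual L f * L a"
proof (cases "L a = 0")
  case True
  have "r * \<bar>f a\<bar> \<le> lip_dual L f" if "r \<ge> 0" for r
    using lip_dual_upper[OF b, of "r *\<^sub>R a"] that True
    by (simp add: seminorm_scale[OF L] linear_cmul[OF f] abs_mult)
  from this[of "(lip_dual L f + 1) / \<bar>f a\<bar>"] have "f a = 0"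
    using lip_dual_nonneg[OF L b] by (cases "f a = 0") auto
  then show ?thesis using True by simp
next
  case False
  then have pos: "L a > 0" using seminorm_nonneg[OF L, of a] by simp
  then have "\<bar>f (inverse (L a) *\<^sub>R a)\<bar> \<le> lip_dual L f"
    by (intro lip_dual_upper[OF b]) (simp add: seminorm_scale[OF L])
  then show ?thesis
    using pos by (simp add: linear_cmul[OF f] abs_mult field_simps)
qed

lemma rho_le_iff:
  "0 \<le> r \<Longrightarrow> rho L \<mu> \<nu> \<le> ennreal r \<longleftrightarrow> (\<forall>a. L a \<le> 1 \<longrightarrow> \<bar>\<mu> a - \<nu> a\<bar> \<le> r)"
  by (auto simp: rho_def SUP_le_iff ennreal_le_iff)

lemma rho_eq_lip_dual:
  assumes L: "seminorm L" and b: "lip_bounded L (\<lambda>a. \<mu> a - \<nu> a)"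
  shows "rho L \<mu> \<nu> = ennreal (lip_dual L (\<lambda>a. \<mu> a - \<nu> a))"
proof (rule antisym)
  show "rho L \<mu> \<nu> \<le> ennreal (lip_dual L (\<lambda>a. \<mu> a - \<nu> a))"
    using lip_dual_nonneg[OF L b] lip_dual_upper[OF b] by (simp add: rho_le_iff)
  show "ennreal (lip_dual L (\<lambda>a. \<mu> a - \<nu> a)) \<le> rho L \<mu> \<nu>"
  proof (cases "rho L \<mu> \<nu>")
    case (real r)
    then have "\<bar>\<mu> a - \<nu> a\<bar> \<le> r" if "L a \<le> 1" for a
      using rho_le_iff[of r L \<mu> \<nu>] that by simp
    then show ?thesis
      using real by (simp add: lip_dual_least[OF L] ennreal_leI)
  qed simp
qed

section \<open>Lip-norms\<close>

lemma open_finite_neighbourhood: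
  fixes \<mu> :: "'a \<Rightarrow> real"
  assumes "finite F"
  shows "open {\<nu>. \<forall>a\<in>F. \<bar>\<mu> a - \<nu> a\<bar> < \<delta>}"
proof -
  have "open {\<nu>::'a \<Rightarrow> real. \<bar>\<mu> a - \<nu> a\<bar> < \<delta>}" for a
    by (intro open_Collect_less continuous_intros continuous_on_product_coordinates)
  then have "open (\<Inter>a\<in>F. {\<nu>::'a \<Rightarrow> real. \<bar>\<mu> a - \<nu> a\<bar> < \<delta>})"
    using assms by (intro open_INT) auto
  moreover have "(\<Inter>a\<in>F. {\<nu>. \<bar>\<mu> a - \<nu> a\<bar> < \<delta>}) = {\<nu>. \<forall>a\<in>F. \<bar>\<mu> a - \<nu> a\<bar> < \<delta>}"
    by auto
  ultimately show ?thesis by simp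
qed

lemma open_contains_finite_neighbourhood:
  fixes \<mu> :: "'a \<Rightarrow> real"
  assumes "open T" "\<mu> \<in> T"
  obtains F \<delta> where "finite F" "\<delta> > 0" "{\<nu>. \<forall>a\<in>F. \<bar>\<mu> a - \<nu> a\<bar> < \<delta>} \<subseteq> T"
proof -
  have "openin (product_topology (\<lambda>_. euclidean) UNIV) T"
    using assms(1) by (simp add: open_fun_def)
  from product_topology_open_contains_basis[OF this assms(2)]
  have "\<exists>X. \<mu> \<in> (\<Pi>\<^sub>E i\<in>UNIV. X i) \<and> (\<forall>i. open (X i)) \<and> finite {i. X i \<noteq> UNIV} \<and>
      (\<Pi>\<^sub>E i\<in>UNIV. X i) \<subseteq> T"
    by (simp only: open_openin topspace_euclidean)
  then obtain X :: "'a \<Rightarrow> real set" where X: "\<mu> \<in> (\<Pi>\<^sub>E i\<in>UNIV. X i)" "\<And>i. open (X i)"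
    "finite {i. X i \<noteq> UNIV}" "(\<Pi>\<^sub>E i\<in>UNIV. X i) \<subseteq> T"
    by (elim exE conjE) (rule that, simp_all)
  define F where "F = {i. X i \<noteq> UNIV}"
  have "\<forall>i. \<exists>\<epsilon>>0. ball (\<mu> i) \<epsilon> \<subseteq> X i"
    using X(1,2) by (auto simp: open_contains_ball PiE_iff)
  then obtain \<epsilon> where \<epsilon>: "\<And>i. \<epsilon> i > 0" "\<And>i. ball (\<mu> i) (\<epsilon> i) \<subseteq> X i"
    unfolding choice_iff by blast
  define \<delta> where "\<delta> = Min (insert 1 (\<epsilon> ` F))"
  have F: "finite F" using X(3) by (simp add: F_def)
  have \<delta>_le: "\<delta> \<le> \<epsilon> i" if "i \<in> F" for i
    unfolding \<delta>_def using F that by (intro Min_le) auto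
  have "\<delta> > 0" unfolding \<delta>_def using F \<epsilon>(1) by (subst Min_gr_iff) auto
  moreover have "\<nu> \<in> T" if "\<forall>a\<in>F. \<bar>\<mu> a - \<nu> a\<bar> < \<delta>" for \<nu>
  proof -
    have "\<nu> i \<in> X i" for i
    proof (cases "i \<in> F")
      case True
      then show ?thesis
        using that \<delta>_le \<epsilon>(2)[of i] by (auto simp: dist_real_def subset_iff intro: less_le_trans)
    qed (simp add: F_def)
    then show ?thesis using X(4) by (auto simp: PiE_iff)
  qed
  ultimately show thesis using that[OF F] by blast
qed

text \<open>
  The topology of \<open>\<rho>\<^sub>L\<close> is always finer than the weak-* topology, because \<open>L\<close> is finite and a
  state difference vanishes on the kernel of \<open>L\<close>. So the topological condition on a Lip-norm only
  says that weak-* closeness, tested on finitely many elements, implies \<open>\<rho>\<^sub>L\<close>-closeness.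
\<close>

lemma lip_norm_iff:
  fixes e :: "'a::ordered_real_vector"
  assumes e: "order_unit_space e" and L: "seminorm L"
    and ker: "\<And>a. L a = 0 \<longleftrightarrow> a \<in> range (\<lambda>r::real. r *\<^sub>R e)"
  shows "lip_norm e L \<longleftrightarrow>
     (\<forall>\<mu>\<in>states e. \<forall>\<epsilon>>0. \<exists>F \<delta>. finite F \<and> 0 < \<delta> \<and>
        (\<forall>\<nu>\<in>states e. (\<forall>a\<in>F. \<bar>\<mu> a - \<nu> a\<bar> < \<delta>) \<longrightarrow> rho L \<mu> \<nu> < ennreal \<epsilon>))"
    (is "_ \<longleftrightarrow> ?R")
proof -
  have "lip_norm e L \<longleftrightarrow> ext_metric_topology (states e) (rho L) = top_of_set (states e)"
    using L ker by (simp add: lip_norm_def weak_star_states_eq[OF e])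
  also have "\<dots> \<longleftrightarrow> ?R"
  proof
    assume eq: "ext_metric_topology (states e) (rho L) = top_of_set (states e)"
    show ?R
    proof (intro ballI allI impI)
      fix \<mu> \<epsilon> assume \<mu>: "\<mu> \<in> states e" and \<epsilon>: "(\<epsilon>::real) > 0"
      define U where "U = {\<nu>\<in>states e. rho L \<mu> \<nu> < ennreal \<epsilon>}"
      have triangle: "rho L \<mu> \<kappa> \<le> rho L \<mu> \<nu> + rho L \<nu> \<kappa>" for \<nu> \<kappa>
        unfolding rho_def
      proof (rule SUP_least)
        fix a assume a: "a \<in> {a. L a \<le> 1}"
        have "ennreal \<bar>\<mu> a - \<kappa> a\<bar> \<le> ennreal \<bar>\<mu> a - \<nu> a\<bar> + ennreal \<bar>\<nu> a - \<kappa> a\<bar>"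
          by (simp flip: ennreal_plus)
        also have "\<dots> \<le> (SUP a\<in>{a. L a \<le> 1}. ennreal \<bar>\<mu> a - \<nu> a\<bar>) +
            (SUP a\<in>{a. L a \<le> 1}. ennreal \<bar>\<nu> a - \<kappa> a\<bar>)"
          using a by (intro add_mono SUP_upper)
        finally show "ennreal \<bar>\<mu> a - \<kappa> a\<bar> \<le> \<dots>" .
      qed
      have "openin (ext_metric_topology (states e) (rho L)) U"
        unfolding openin_ext_metric_topology
      proof (intro conjI ballI)
        fix \<nu> assume "\<nu> \<in> U"
        then have lt: "rho L \<mu> \<nu> < ennreal \<epsilon>" by (simp add: U_def)
        show "\<exists>\<eta>>0. \<forall>\<kappa>\<in>states e. rho L \<nu> \<kappa> < \<eta> \<longrightarrow> \<kappa> \<in> U"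
        proof (intro exI conjI ballI impI)
          show "0 < ennreal \<epsilon> - rho L \<mu> \<nu>"
            using lt by (simp add: diff_gr0_ennreal)
          fix \<kappa> assume "\<kappa> \<in> states e" and "rho L \<nu> \<kappa> < ennreal \<epsilon> - rho L \<mu> \<nu>"
          then have "rho L \<mu> \<nu> + rho L \<nu> \<kappa> < ennreal \<epsilon>"
            using lt \<epsilon> by (cases "rho L \<mu> \<nu>"; cases "rho L \<nu> \<kappa>")
              (auto simp: ennreal_minus ennreal_less_iff simp flip: ennreal_plus)
          then show "\<kappa> \<in> U"
            using triangle[of \<kappa> \<nu>] \<open>\<kappa> \<in> states e\<close> by (auto simp: U_def intro: le_less_trans)
        qed
      qed (auto simp: U_def)
      then obtain T where T: "open T" "U = states e \<inter> T"
        unfolding eq by (auto simp: openin_open)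
      moreover have "rho L \<mu> \<mu> \<le> ennreal 0" by (simp add: rho_le_iff del: ennreal_0)
      then have "\<mu> \<in> U" using \<mu> \<epsilon> by (simp add: U_def)
      ultimately obtain F \<delta> where "finite F" "\<delta> > 0" "{\<nu>. \<forall>a\<in>F. \<bar>\<mu> a - \<nu> a\<bar> < \<delta>} \<subseteq> T"
        using open_contains_finite_neighbourhood[of T \<mu>] by blast
      then show "\<exists>F \<delta>. finite F \<and> 0 < \<delta> \<and>
          (\<forall>\<nu>\<in>states e. (\<forall>a\<in>F. \<bar>\<mu> a - \<nu> a\<bar> < \<delta>) \<longrightarrow> rho L \<mu> \<nu> < ennreal \<epsilon>)"
        using T(2) U_def by blast
    qed
  next
    assume R: ?R
    show "ext_metric_topology (states e) (rho L) = top_of_set (states e)"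
      unfolding topology_eq openin_ext_metric_topology
    proof (intro allI iffI)
      fix U assume U: "U \<subseteq> states e \<and> (\<forall>\<mu>\<in>U. \<exists>\<epsilon>>0. \<forall>\<nu>\<in>states e. rho L \<mu> \<nu> < \<epsilon> \<longrightarrow> \<nu> \<in> U)"
      have "\<exists>T. open T \<and> \<mu> \<in> T \<and> states e \<inter> T \<subseteq> U" if \<mu>: "\<mu> \<in> U" for \<mu>
      proof -
        obtain \<epsilon>' where \<epsilon>': "\<epsilon>' > 0" "\<And>\<nu>. \<nu> \<in> states e \<Longrightarrow> rho L \<mu> \<nu> < \<epsilon>' \<Longrightarrow> \<nu> \<in> U"
          using U \<mu> by blast
        obtain \<epsilon> :: real where \<epsilon>: "\<epsilon> > 0" "ennreal \<epsilon> \<le> \<epsilon>'"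
          using \<epsilon>'(1) by (cases \<epsilon>') (auto intro: that[of 1])
        have "\<mu> \<in> states e" using \<mu> U by blast
        from R[rule_format, OF this \<epsilon>(1)] obtain F \<delta> where F: "finite F" "\<delta> > 0"
          "\<And>\<nu>. \<nu> \<in> states e \<Longrightarrow> \<forall>a\<in>F. \<bar>\<mu> a - \<nu> a\<bar> < \<delta> \<Longrightarrow> rho L \<mu> \<nu> < ennreal \<epsilon>"
          by blast
        show ?thesis
          using F \<epsilon>(2) \<epsilon>'(2) open_finite_neighbourhood[OF F(1), of \<mu> \<delta>]
          by (intro exI[of _ "{\<nu>. \<forall>a\<in>F. \<bar>\<mu> a - \<nu> a\<bar> < \<delta>}"]) (auto intro: less_le_trans)
      qed
      then obtain T where T: "\<And>\<mu>. \<mu> \<in> U \<Longrightarrow> open (T \<mu>) \<and> \<mu> \<in> T \<mu> \<and> states e \<inter> T \<mu> \<subseteq> U"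
        by metis
      have "U = states e \<inter> (\<Union>\<mu>\<in>U. T \<mu>)" using T U by blast
      moreover have "open (\<Union>\<mu>\<in>U. T \<mu>)" using T by blast
      ultimately show "openin (top_of_set (states e)) U" by (auto simp: openin_open)
    next
      fix U assume "openin (top_of_set (states e)) U"
      then obtain T where T: "open T" "U = states e \<inter> T" by (auto simp: openin_open)
      show "U \<subseteq> states e \<and> (\<forall>\<mu>\<in>U. \<exists>\<epsilon>>0. \<forall>\<nu>\<in>states e. rho L \<mu> \<nu> < \<epsilon> \<longrightarrow> \<nu> \<in> U)"
      proof (intro conjI ballI)
        fix \<mu> assume \<mu>: "\<mu> \<in> U"
        then obtain F \<delta> where F: "finite F" "\<delta> > 0" "{\<nu>. \<forall>a\<in>F. \<bar>\<mu> a - \<nu> a\<bar> < \<delta>} \<subseteq> T"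
          using open_contains_finite_neighbourhood[of T \<mu>] T by blast
        define M where "M = 1 + (\<Sum>a\<in>F. L a)"
        have M: "L a < M" if "a \<in> F" for a
          using member_le_sum[of a F L] that F(1) seminorm_nonneg[OF L] by (simp add: M_def)
        have "M > 0" using seminorm_nonneg[OF L] by (simp add: M_def sum_nonneg add_pos_nonneg)
        show "\<exists>\<epsilon>>0. \<forall>\<nu>\<in>states e. rho L \<mu> \<nu> < \<epsilon> \<longrightarrow> \<nu> \<in> U"
        proof (intro exI conjI ballI impI)
          show "0 < ennreal (\<delta> / M)" using F(2) \<open>M > 0\<close> by simp
          fix \<nu> assume \<nu>: "\<nu> \<in> states e" and lt: "rho L \<mu> \<nu> < ennreal (\<delta> / M)"
          have "0 \<le> \<delta> / M" using F(2) \<open>M > 0\<close> by simp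
          then have close: "\<bar>\<mu> a - \<nu> a\<bar> \<le> \<delta> / M" if "L a \<le> 1" for a
            using less_imp_le[OF lt] that rho_le_iff[of "\<delta> / M" L \<mu> \<nu>] by blast
          have lin: "linear (\<lambda>a. \<mu> a - \<nu> a)"
            using \<mu> \<nu> T(2) by (intro linear_compose_sub state_linear[OF e]) simp_all
          have b: "lip_bounded L (\<lambda>a. \<mu> a - \<nu> a)"
            using close by (rule lip_boundedI)
          have "\<bar>\<mu> a - \<nu> a\<bar> < \<delta>" if "a \<in> F" for a
          proof -
            have "\<bar>\<mu> a - \<nu> a\<bar> \<le> lip_dual L (\<lambda>a. \<mu> a - \<nu> a) * L a"
              by (rule lip_dual_bound[OF L lin b])
            also have "\<dots> \<le> (\<delta> / M) * L a"
              using close by (intro mult_right_mono lip_dual_least[OF L] seminorm_nonneg[OF L]) auto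
            also have "\<dots> < (\<delta> / M) * M"
              using M[OF that] F(2) \<open>M > 0\<close> by (intro mult_strict_left_mono) auto
            finally show ?thesis using \<open>M > 0\<close> by simp
          qed
          then show "\<nu> \<in> U" using F(3) T(2) \<nu> by blast
        qed
      qed (use T in auto)
    qed
  qed
  finally show ?thesis .
qed

context
  fixes e :: "'a::ordered_real_vector" and L :: "'a \<Rightarrow> real"
  assumes e: "order_unit_space e" and lip: "lip_norm e L"
begin

lemma lip_seminorm: "seminorm L"
  and lip_kernel: "L a = 0 \<longleftrightarrow> a \<in> range (\<lambda>r::real. r *\<^sub>R e)"
  using lip by (simp_all add: lip_norm_def)

lemma lip_unit: "L (r *\<^sub>R e) = 0"
  using lip_kernel by blast

lemma lip_add_unit: "L (a + r *\<^sub>R e) = L a"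
  using seminorm_add[OF lip_seminorm, of a "r *\<^sub>R e"]
    seminorm_diff[OF lip_seminorm, of "a + r *\<^sub>R e" "r *\<^sub>R e"]
  by (simp add: lip_unit)

lemma lip_norm_neighbourhood:
  assumes "\<mu> \<in> states e" "\<epsilon> > 0"
  obtains F \<delta> where "finite F" "0 < \<delta>"
    "\<And>\<nu>. \<nu> \<in> states e \<Longrightarrow> \<forall>a\<in>F. \<bar>\<mu> a - \<nu> a\<bar> < \<delta> \<Longrightarrow> rho L \<mu> \<nu> < ennreal \<epsilon>"
proof -
  have "\<forall>\<mu>\<in>states e. \<forall>\<epsilon>>0. \<exists>F \<delta>. finite F \<and> 0 < \<delta> \<and>
      (\<forall>\<nu>\<in>states e. (\<forall>a\<in>F. \<bar>\<mu> a - \<nu> a\<bar> < \<delta>) \<longrightarrow> rho L \<mu> \<nu> < ennreal \<epsilon>)"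
    using lip by (simp only: lip_norm_iff[OF e lip_seminorm lip_kernel])
  from this[rule_format, OF assms] show thesis using that by blast
qed

text \<open>
  A weak-* neighbourhood of \<open>\<mu>\<close> given by finitely many elements contains \<open>(1 - s) \<mu> + s \<nu>\<close> for all
  states \<open>\<nu>\<close> at once, provided \<open>s\<close> is small. As \<open>\<rho>\<^sub>L\<close> scales along segments, it is bounded.
\<close>

lemma state_diff_bounded:
  obtains D where "D \<ge> 0"
    "\<And>\<mu> \<nu> a. \<mu> \<in> states e \<Longrightarrow> \<nu> \<in> states e \<Longrightarrow> L a \<le> 1 \<Longrightarrow> \<bar>\<mu> a - \<nu> a\<bar> \<le> D"
proof -
  obtain \<mu>\<^sub>0 where \<mu>\<^sub>0: "\<mu>\<^sub>0 \<in> states e" using states_nonempty[OF e] by blast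
  obtain F \<delta> where F: "finite F" "0 < \<delta>"
    "\<And>\<nu>. \<nu> \<in> states e \<Longrightarrow> \<forall>a\<in>F. \<bar>\<mu>\<^sub>0 a - \<nu> a\<bar> < \<delta> \<Longrightarrow> rho L \<mu>\<^sub>0 \<nu> < ennreal 1"
    using lip_norm_neighbourhood[OF \<mu>\<^sub>0, of 1] by auto
  define M where "M = 1 + (\<Sum>a\<in>F. 2 * ou_norm e a)"
  have M: "2 * ou_norm e a < M" if "a \<in> F" for a
    using member_le_sum[of a F "\<lambda>a. 2 * ou_norm e a"] that F(1) ou_norm_nonneg[OF e]
    by (simp add: M_def)
  have "M \<ge> 1" using ou_norm_nonneg[OF e] by (simp add: M_def sum_nonneg)
  define s where "s = min 1 (\<delta> / M)"
  have s: "0 < s" "s \<le> 1" "s * M \<le> \<delta>"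
    using F(2) \<open>M \<ge> 1\<close> by (auto simp: s_def min_def field_simps)
  have base: "\<bar>\<mu>\<^sub>0 a - \<nu> a\<bar> \<le> 1 / s" if \<nu>: "\<nu> \<in> states e" and a: "L a \<le> 1" for \<nu> a
  proof -
    define \<kappa> where "\<kappa> = (\<lambda>a. (1 - s) * \<mu>\<^sub>0 a + s * \<nu> a)"
    have "\<mu>\<^sub>0 a - \<kappa> a = s * (\<mu>\<^sub>0 a - \<nu> a)" for a
      by (simp add: \<kappa>_def algebra_simps)
    then have abs_diff: "\<bar>\<mu>\<^sub>0 a - \<kappa> a\<bar> = s * \<bar>\<mu>\<^sub>0 a - \<nu> a\<bar>" for a
      using s(1) by (simp add: abs_mult)
    have "\<kappa> \<in> states e"
      unfolding \<kappa>_def using s by (intro states_convex[OF e \<mu>\<^sub>0 \<nu>]) auto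
    moreover have "\<bar>\<mu>\<^sub>0 a - \<kappa> a\<bar> < \<delta>" if "a \<in> F" for a
    proof -
      have "\<bar>\<mu>\<^sub>0 a - \<nu> a\<bar> < M"
        using state_bound[OF e \<mu>\<^sub>0, of a] state_bound[OF e \<nu>, of a] M[OF that] by linarith
      then have "s * \<bar>\<mu>\<^sub>0 a - \<nu> a\<bar> < s * M" using s(1) by simp
      then show ?thesis using s(3) abs_diff[of a] by linarith
    qed
    ultimately have "rho L \<mu>\<^sub>0 \<kappa> \<le> ennreal 1" using F(3) by (intro less_imp_le) auto
    then have "\<bar>\<mu>\<^sub>0 a - \<kappa> a\<bar> \<le> 1"
      using a rho_le_iff[of 1 L \<mu>\<^sub>0 \<kappa>] by auto
    then have "s * \<bar>\<mu>\<^sub>0 a - \<nu> a\<bar> \<le> 1" by (simp only: abs_diff)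
    then show ?thesis using s(1) by (simp add: pos_le_divide_eq mult.commute)
  qed
  have "\<bar>\<mu> a - \<nu> a\<bar> \<le> 2 / s" if "\<mu> \<in> states e" "\<nu> \<in> states e" "L a \<le> 1" for \<mu> \<nu> a
    using base[OF that(1,3)] base[OF that(2,3)] by simp
  then show thesis using that[of "2 / s"] s(1) by simp
qed

lemma state_diff_lip_bounded:
  assumes "\<mu> \<in> states e" "\<nu> \<in> states e"
  shows "lip_bounded L (\<lambda>a. \<mu> a - \<nu> a)"
proof -
  obtain D where D: "D \<ge> 0"
    "\<And>\<mu> \<nu> a. \<mu> \<in> states e \<Longrightarrow> \<nu> \<in> states e \<Longrightarrow> L a \<le> 1 \<Longrightarrow> \<bar>\<mu> a - \<nu> a\<bar> \<le> D"
    by (rule state_diff_bounded) (rule that)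
  from D(2)[OF assms] show ?thesis by (rule lip_boundedI)
qed

lemma rho_states:
  assumes "\<mu> \<in> states e" "\<nu> \<in> states e"
  shows "rho L \<mu> \<nu> = ennreal (lip_dual L (\<lambda>a. \<mu> a - \<nu> a))"
  using rho_eq_lip_dual[OF lip_seminorm state_diff_lip_bounded[OF assms]] .

lemma state_diff_le:
  assumes "\<mu> \<in> states e" "\<nu> \<in> states e" "L a \<le> 1"
  shows "\<bar>\<mu> a - \<nu> a\<bar> \<le> lip_dual L (\<lambda>a. \<mu> a - \<nu> a)"
  using lip_dual_upper[OF state_diff_lip_bounded[OF assms(1,2)] assms(3)] .

text \<open>Compactness of the state space enters the minimax argument in the form of finite nets.\<close>

lemma states_finite_net:
  assumes \<epsilon>: "\<epsilon> > 0"
  obtains N where "finite N" "N \<subseteq> states e"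
    "\<And>\<nu>. \<nu> \<in> states e \<Longrightarrow> \<exists>\<mu>\<in>N. lip_dual L (\<lambda>a. \<mu> a - \<nu> a) < \<epsilon>"
proof -
  have "\<exists>T. open T \<and> \<mu> \<in> T \<and> (\<forall>\<nu>\<in>states e \<inter> T. lip_dual L (\<lambda>a. \<mu> a - \<nu> a) < \<epsilon>)"
    if \<mu>: "\<mu> \<in> states e" for \<mu>
  proof -
    obtain F \<delta> where F: "finite F" "0 < \<delta>"
      "\<And>\<nu>. \<nu> \<in> states e \<Longrightarrow> \<forall>a\<in>F. \<bar>\<mu> a - \<nu> a\<bar> < \<delta> \<Longrightarrow> rho L \<mu> \<nu> < ennreal \<epsilon>"
      by (rule lip_norm_neighbourhood[OF \<mu> \<epsilon>]) (rule that)
    have "lip_dual L (\<lambda>a. \<mu> a - \<nu> a) < \<epsilon>"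
      if "\<nu> \<in> states e" "\<forall>a\<in>F. \<bar>\<mu> a - \<nu> a\<bar> < \<delta>" for \<nu>
      using F(3)[OF that] rho_states[OF \<mu> that(1)] \<epsilon>
        lip_dual_nonneg[OF lip_seminorm state_diff_lip_bounded[OF \<mu> that(1)]]
      by (simp add: ennreal_less_iff)
    then show ?thesis
      using open_finite_neighbourhood[OF F(1), of \<mu> \<delta>] F(2)
      by (intro exI[of _ "{\<nu>. \<forall>a\<in>F. \<bar>\<mu> a - \<nu> a\<bar> < \<delta>}"]) auto
  qed
  then obtain T where T: "\<And>\<mu>. \<mu> \<in> states e \<Longrightarrow> open (T \<mu>) \<and> \<mu> \<in> T \<mu> \<and>
      (\<forall>\<nu>\<in>states e \<inter> T \<mu>. lip_dual L (\<lambda>a. \<mu> a - \<nu> a) < \<epsilon>)"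
    by metis
  obtain N where "N \<subseteq> states e" "finite N" "states e \<subseteq> (\<Union>\<mu>\<in>N. T \<mu>)"
    using compactE_image[OF compact_states[OF e], of "states e" T] T by blast
  then show thesis using T by (intro that[of N]) blast+
qed

end

section \<open>A minimax principle\<close>

text \<open>
  Points \<open>x\<close> with \<open>h x > 0\<close> bound the admissible ratio \<open>q / p\<close> of the weights from below and points \<open>y\<close>
  with \<open>g y > 0\<close> bound it from above. A conflict between two such bounds would produce, by
  concavity, a point on the segment from \<open>x\<close> to \<open>y\<close> with \<open>h > 0\<close> and \<open>g \<ge> 0\<close>.
\<close>

lemma two_function_minimax:
  fixes h g :: "'x \<Rightarrow> real"
  assumes conc: "\<And>x y t. x \<in> X \<Longrightarrow> y \<in> X \<Longrightarrow> t \<in> {0..1} \<Longrightarrow>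
      \<exists>z\<in>X. (1 - t) * h x + t * h y \<le> h z \<and> (1 - t) * g x + t * g y \<le> g z"
    and excl: "\<And>x. x \<in> X \<Longrightarrow> g x \<ge> 0 \<Longrightarrow> h x \<le> 0"
  obtains p q :: real where "p \<ge> 0" "q \<ge> 0" "p + q = 1" "\<And>x. x \<in> X \<Longrightarrow> p * h x + q * g x \<le> 0"
proof -
  define A where "A = {x\<in>X. h x > 0}"
  have gA: "g x < 0" if "x \<in> A" for x
    using excl[of x] that by (force simp: A_def)
  have key: "h x / (- g x) \<le> - h y / g y" if x: "x \<in> A" and y: "y \<in> X" "g y > 0" for x y
  proof -
    define t where "t = - g x / (g y - g x)"
    have d: "g y - g x > 0" using gA[OF x] y by simp
    have t: "t \<in> {0..1}" "1 - t = g y / (g y - g x)"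
      using gA[OF x] y d by (auto simp: t_def field_simps)
    obtain z where z: "z \<in> X" "(1 - t) * h x + t * h y \<le> h z" "(1 - t) * g x + t * g y \<le> g z"
      using conc[of x y t] x y t by (auto simp: A_def)
    have "(1 - t) * g x + t * g y = 0"
      using d by (simp add: t(2)) (simp add: t_def field_simps)
    then have "h z \<le> 0" using z excl by simp
    then have "(1 - t) * h x + t * h y \<le> 0" using z by simp
    then have "(g y * h x - g x * h y) / (g y - g x) \<le> 0"
      by (simp add: t(2)) (simp add: t_def diff_divide_distrib)
    then have "g y * h x \<le> g x * h y" using d by (simp add: divide_le_0_iff)
    then show ?thesis using gA[OF x] y by (simp add: field_simps)
  qed
  show thesis
  proof (cases "A = {} \<or> (\<forall>y\<in>X. g y \<le> 0)")
    case True
    then show thesis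
      using that[of 1 0] that[of 0 1] by (force simp: A_def)
  next
    case False
    then obtain x0 y0 where x0: "x0 \<in> A" and y0: "y0 \<in> X" "g y0 > 0" by force
    define s where "s = (SUP x\<in>A. h x / (- g x))"
    have bdd: "bdd_above ((\<lambda>x. h x / (- g x)) ` A)"
      by (rule bdd_aboveI2) (rule key[OF _ y0])
    have lower: "h x / (- g x) \<le> s" if "x \<in> A" for x
      unfolding s_def by (rule cSUP_upper[OF that bdd])
    have upper: "s \<le> - h y / g y" if "y \<in> X" "g y > 0" for y
      unfolding s_def using x0 key[OF _ that] by (intro cSUP_least) auto
    have "0 \<le> h x0 / (- g x0)"
      using x0 gA[OF x0] by (intro divide_nonneg_nonneg) (simp_all add: A_def)
    then have s: "s \<ge> 0" using lower[OF x0] by simp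
    have "h x + s * g x \<le> 0" if x: "x \<in> X" for x
    proof -
      consider "x \<in> A" | "g x > 0" | "h x \<le> 0" "g x \<le> 0" using x by (force simp: A_def)
      then show ?thesis
      proof cases
        case 1
        then show ?thesis using lower[OF 1] gA[OF 1] by (simp add: field_simps)
      next
        case 2
        then show ?thesis using upper[OF x 2] by (simp add: field_simps)
      next
        case 3
        then show ?thesis using s by (simp add: add_nonpos_nonpos mult_nonneg_nonpos)
      qed
    qed
    then have "(h x + s * g x) / (1 + s) \<le> 0" if "x \<in> X" for x
      using s that by (intro divide_nonpos_pos) auto
    then have "1 / (1 + s) * h x + s / (1 + s) * g x \<le> 0" if "x \<in> X" for x
      using that by (simp add: add_divide_distrib)
    moreover have "1 / (1 + s) + s / (1 + s) = 1"
      using s by (simp flip: add_divide_distrib)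
    ultimately show thesis using that[of "1 / (1 + s)" "s / (1 + s)"] s by simp
  qed
qed

text \<open>
  Only the values of the \<open>f i\<close> matter, so concavity is required in Fan's form, without a linear
  structure on \<open>X\<close>. In the induction the new function is \<open>f i\<close>; the hypothesis is applied to the
  subset of \<open>X\<close> where \<open>f i \<ge> 0\<close>, on which the remaining functions satisfy the same condition.
\<close>

lemma finite_minimax:
  fixes f :: "'i \<Rightarrow> 'x \<Rightarrow> real"
  assumes "finite I" "I \<noteq> {}"
    and "\<And>x y t. x \<in> X \<Longrightarrow> y \<in> X \<Longrightarrow> t \<in> {0..1} \<Longrightarrow>
      \<exists>z\<in>X. \<forall>i\<in>I. (1 - t) * f i x + t * f i y \<le> f i z"
    and "\<And>x. x \<in> X \<Longrightarrow> \<exists>i\<in>I. f i x < 0"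
  shows "\<exists>w. (\<forall>i\<in>I. 0 \<le> w i) \<and> sum w I = 1 \<and> (\<forall>x\<in>X. (\<Sum>i\<in>I. w i * f i x) \<le> 0)"
  using assms
proof (induction I arbitrary: X rule: finite_ne_induct)
  case (singleton i)
  then show ?case by (intro exI[of _ "\<lambda>_. 1"]) force
next
  case (insert i I)
  note conc = insert.prems(1) and neg = insert.prems(2)
  have "\<exists>w. (\<forall>j\<in>I. 0 \<le> w j) \<and> sum w I = 1 \<and>
      (\<forall>x\<in>{x\<in>X. f i x \<ge> 0}. (\<Sum>j\<in>I. w j * f j x) \<le> 0)"
  proof (rule insert.IH)
    fix x y and t :: real
    assume x: "x \<in> {x\<in>X. f i x \<ge> 0}" and y: "y \<in> {x\<in>X. f i x \<ge> 0}" and t: "t \<in> {0..1}"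
    obtain z where z: "z \<in> X" "\<And>j. j \<in> insert i I \<Longrightarrow> (1 - t) * f j x + t * f j y \<le> f j z"
      using conc[of x y t] x y t by blast
    have "0 \<le> (1 - t) * f i x + t * f i y" using x y t by simp
    then have "f i z \<ge> 0" using z(2)[of i] by simp
    then show "\<exists>z\<in>{x\<in>X. f i x \<ge> 0}. \<forall>j\<in>I. (1 - t) * f j x + t * f j y \<le> f j z"
      using z by blast
  next
    fix x assume "x \<in> {x\<in>X. f i x \<ge> 0}"
    then show "\<exists>j\<in>I. f j x < 0" using neg[of x] by force
  qed
  then obtain w where w: "\<And>j. j \<in> I \<Longrightarrow> 0 \<le> w j" "sum w I = 1"
    and w_le: "\<And>x. x \<in> X \<Longrightarrow> f i x \<ge> 0 \<Longrightarrow> (\<Sum>j\<in>I. w j * f j x) \<le> 0"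
    by blast
  define h where "h = (\<lambda>x. \<Sum>j\<in>I. w j * f j x)"
  obtain p q where pq: "p \<ge> 0" "q \<ge> 0" "p + q = 1" "\<And>x. x \<in> X \<Longrightarrow> p * h x + q * f i x \<le> 0"
  proof (rule two_function_minimax[of X h "f i"])
    fix x y and t :: real
    assume x: "x \<in> X" and y: "y \<in> X" and t: "t \<in> {0..1}"
    obtain z where z: "z \<in> X" "\<And>j. j \<in> insert i I \<Longrightarrow> (1 - t) * f j x + t * f j y \<le> f j z"
      using conc[OF x y t] by blast
    have "(1 - t) * h x + t * h y = (\<Sum>j\<in>I. w j * ((1 - t) * f j x + t * f j y))"
      by (simp add: h_def sum_distrib_left distrib_left sum.distrib mult.left_commute)
    also have "\<dots> \<le> h z"
      unfolding h_def using w z(2) by (intro sum_mono mult_left_mono) auto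
    finally show "\<exists>z\<in>X. (1 - t) * h x + t * h y \<le> h z \<and> (1 - t) * f i x + t * f i y \<le> f i z"
      using z by blast
  next
    fix x assume "x \<in> X" "f i x \<ge> 0"
    then show "h x \<le> 0" by (simp add: h_def w_le)
  qed (rule that)
  define w' where "w' = (\<lambda>j. if j = i then q else p * w j)"
  have split: "(\<Sum>j\<in>insert i I. w' j * v j) = q * v i + p * (\<Sum>j\<in>I. w j * v j)" for v
  proof -
    have "(\<Sum>j\<in>I. w' j * v j) = (\<Sum>j\<in>I. p * (w j * v j))"
      using insert.hyps by (intro sum.cong) (auto simp: w'_def)
    then show ?thesis
      using insert.hyps by (simp add: sum_distrib_left w'_def)
  qed
  have "\<forall>j\<in>insert i I. 0 \<le> w' j" using pq w by (simp add: w'_def)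
  moreover have "sum w' (insert i I) = 1" using split[of "\<lambda>_. 1"] w pq by simp
  moreover have "(\<Sum>j\<in>insert i I. w' j * f j x) \<le> 0" if "x \<in> X" for x
    using split[of "\<lambda>j. f j x"] pq(4)[OF that] by (simp add: h_def add.commute)
  ultimately show ?case by blast
qed

section \<open>Bridges between state spaces\<close>

abbreviation state_dist :: "('a::real_vector \<Rightarrow> real) \<Rightarrow> ('a \<Rightarrow> real) \<Rightarrow> ('a \<Rightarrow> real) \<Rightarrow> real" where
  "state_dist L \<mu> \<nu> \<equiv> lip_dual L (\<lambda>a. \<mu> a - \<nu> a)"

lemma state_dist_commute: "state_dist L \<mu> \<nu> = state_dist L \<nu> \<mu>"
  by (simp add: lip_dual_def abs_minus_commute)

abbreviation mix :: "real \<Rightarrow> ('a \<Rightarrow> real) \<Rightarrow> ('a \<Rightarrow> real) \<Rightarrow> 'a \<Rightarrow> real" where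
  "mix t \<mu> \<nu> \<equiv> \<lambda>a. (1 - t) * \<mu> a + t * \<nu> a"

text \<open>
  These are the properties of \<open>N \<mu> \<nu> = \<parallel>h\<^sub>A \<mu> - h\<^sub>B \<nu>\<parallel>\<close>, for two affine isometric embeddings into one
  normed space, that survive when the normed space is forgotten. They suffice for the
  construction of a Lip-norm on the sum, and they are symmetric in the two spaces.
\<close>

definition bridge ::
  "'a::ordered_real_vector \<Rightarrow> ('a \<Rightarrow> real) \<Rightarrow> 'b::ordered_real_vector \<Rightarrow> ('b \<Rightarrow> real) \<Rightarrow>
   (('a \<Rightarrow> real) \<Rightarrow> ('b \<Rightarrow> real) \<Rightarrow> real) \<Rightarrow> bool" where
  "bridge eA LA eB LB N \<longleftrightarrow>
     (\<forall>\<mu>\<in>states eA. \<forall>\<nu>\<in>states eB. 0 \<le> N \<mu> \<nu>) \<and>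
     (\<forall>\<mu>\<in>states eA. \<forall>\<mu>'\<in>states eA. \<forall>\<nu>\<in>states eB. \<forall>\<nu>'\<in>states eB.
        (\<forall>t\<in>{0..1}. N (mix t \<mu> \<mu>') (mix t \<nu> \<nu>') \<le> (1 - t) * N \<mu> \<nu> + t * N \<mu>' \<nu>') \<and>
        state_dist LA \<mu> \<mu>' \<le> N \<mu> \<nu> + state_dist LB \<nu> \<nu>' + N \<mu>' \<nu>' \<and>
        state_dist LB \<nu> \<nu>' \<le> N \<mu> \<nu> + state_dist LA \<mu> \<mu>' + N \<mu>' \<nu>' \<and>
        N \<mu>' \<nu>' \<le> N \<mu> \<nu> + state_dist LA \<mu> \<mu>' + state_dist LB \<nu> \<nu>')"

lemma bridge_commute:
  assumes "bridge eA LA eB LB N"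
  shows "bridge eB LB eA LA (\<lambda>\<nu> \<mu>. N \<mu> \<nu>)"
  unfolding bridge_def
proof (intro conjI ballI, goal_cases)
  case (5 \<nu> \<nu>' \<mu> \<mu>')
  then have "N \<mu>' \<nu>' \<le> N \<mu> \<nu> + state_dist LA \<mu> \<mu>' + state_dist LB \<nu> \<nu>'"
    using assms unfolding bridge_def by blast
  then show ?case by simp
qed (use assms in \<open>unfold bridge_def, blast\<close>)+

lemma lip_dual_nearly_attained:
  assumes L: "seminorm L" and f: "linear f" and c: "c < lip_dual L f"
  obtains a where "L a \<le> 1" "c < f a"
proof -
  obtain a where a: "L a \<le> 1" "c < \<bar>f a\<bar>"
    using lip_dual_least[OF L, of f c] c by (meson not_le)
  show thesis
  proof (cases "f a \<ge> 0")
    case True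
    then show thesis using a that[of a] by simp
  next
    case False
    then show thesis
      using a that[of "- a"] by (simp add: linear_neg[OF f] seminorm_minus[OF L])
  qed
qed

text \<open>
  Up to a multiple of the unit, \<open>b\<close> is a partner of \<open>a\<close> when
  \<open>(\<mu> a - \<mu>' a) - (\<nu> b - \<nu>' b) \<le> N \<mu> \<nu> + N \<mu>' \<nu>' + 2 \<epsilon>\<close> for all states. For fixed states such a \<open>b\<close>
  exists, since \<open>\<mu> a - \<mu>' a\<close> is at most the distance of \<open>\<mu>\<close> and \<open>\<mu>'\<close>, the bridge inequality
  compares it with the distance of \<open>\<nu>\<close> and \<open>\<nu>'\<close>, and that distance is nearly attained by some \<open>b\<close>.
  The expression is concave in the states, affine in \<open>b\<close> and Lipschitz in the states uniformly
  in \<open>b\<close>, so finite nets of states and the minimax principle give one \<open>b\<close> for all states.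
\<close>

lemma bridge_partner:
  assumes A: "order_unit_space eA" "lip_norm eA LA" and B: "order_unit_space eB" "lip_norm eB LB"
    and N: "bridge eA LA eB LB N" and \<epsilon>: "\<epsilon> > 0" and a: "LA a \<le> 1"
  obtains b where "LB b \<le> 1"
    "\<And>\<mu> \<nu>. \<mu> \<in> states eA \<Longrightarrow> \<nu> \<in> states eB \<Longrightarrow> \<bar>\<mu> a - \<nu> b\<bar> \<le> N \<mu> \<nu> + \<epsilon>"
proof -
  note LB = lip_seminorm[OF B]
  \<comment> \<open>One \<open>\<eta>\<close> is lost at the points of the net and eight in moving to the nearest of them.\<close>
  define \<eta> where "\<eta> = \<epsilon> / 9"
  have \<eta>: "\<eta> > 0" using \<epsilon> by (simp add: \<eta>_def)
  define X where "X = (states eA \<times> states eB) \<times> (states eA \<times> states eB)"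
  define F where "F = (\<lambda>b ((\<mu>, \<nu>), (\<mu>', \<nu>')). \<mu> a - \<mu>' a - (\<nu> b - \<nu>' b) - N \<mu> \<nu> - N \<mu>' \<nu>')"
  have F: "F b ((\<mu>, \<nu>), (\<mu>', \<nu>')) = \<mu> a - \<mu>' a - (\<nu> b - \<nu>' b) - N \<mu> \<nu> - N \<mu>' \<nu>'" for b \<mu> \<nu> \<mu>' \<nu>'
    by (simp add: F_def)

  have pointwise: "\<exists>b. LB b \<le> 1 \<and> F b x < \<eta>" if x: "x \<in> X" for x
  proof -
    obtain \<mu> \<nu> \<mu>' \<nu>' where x_eq: "x = ((\<mu>, \<nu>), (\<mu>', \<nu>'))"
      and st: "\<mu> \<in> states eA" "\<nu> \<in> states eB" "\<mu>' \<in> states eA" "\<nu>' \<in> states eB"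
      using x by (auto simp: X_def)
    have "linear (\<lambda>b. \<nu> b - \<nu>' b)"
      using st by (intro linear_compose_sub state_linear[OF B(1)])
    then obtain b where b: "LB b \<le> 1" "state_dist LB \<nu> \<nu>' - \<eta> < \<nu> b - \<nu>' b"
      using lip_dual_nearly_attained[OF LB, of "\<lambda>b. \<nu> b - \<nu>' b" "state_dist LB \<nu> \<nu>' - \<eta>"] \<eta>
      by auto
    have "\<mu> a - \<mu>' a \<le> state_dist LA \<mu> \<mu>'"
      using state_diff_le[OF A st(1,3) a] by simp
    also have "\<dots> \<le> N \<mu> \<nu> + state_dist LB \<nu> \<nu>' + N \<mu>' \<nu>'"
      using N st unfolding bridge_def by blast
    finally show ?thesis using b by (intro exI[of _ b]) (simp add: x_eq F)
  qed

  have lipschitz: "F b ((\<mu>, \<nu>), (\<mu>', \<nu>')) < F b ((\<mu>1, \<nu>1), (\<mu>1', \<nu>1')) + 8 * \<eta>"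
    if b: "LB b \<le> 1" and st: "\<mu> \<in> states eA" "\<nu> \<in> states eB" "\<mu>' \<in> states eA" "\<nu>' \<in> states eB"
      "\<mu>1 \<in> states eA" "\<nu>1 \<in> states eB" "\<mu>1' \<in> states eA" "\<nu>1' \<in> states eB"
      and d: "state_dist LA \<mu>1 \<mu> < \<eta>" "state_dist LB \<nu>1 \<nu> < \<eta>"
        "state_dist LA \<mu>1' \<mu>' < \<eta>" "state_dist LB \<nu>1' \<nu>' < \<eta>"
    for b \<mu> \<nu> \<mu>' \<nu>' \<mu>1 \<nu>1 \<mu>1' \<nu>1'
  proof -
    have "N \<mu>1 \<nu>1 \<le> N \<mu> \<nu> + state_dist LA \<mu> \<mu>1 + state_dist LB \<nu> \<nu>1"
      "N \<mu>1' \<nu>1' \<le> N \<mu>' \<nu>' + state_dist LA \<mu>' \<mu>1' + state_dist LB \<nu>' \<nu>1'"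
      using N st unfolding bridge_def by blast+
    moreover note state_diff_le[OF A st(5,1) a] state_diff_le[OF A st(7,3) a]
      state_diff_le[OF B st(6,2) b] state_diff_le[OF B st(8,4) b] d
    ultimately show ?thesis
      unfolding F state_dist_commute[of LA \<mu>] state_dist_commute[of LA \<mu>']
        state_dist_commute[of LB \<nu>] state_dist_commute[of LB \<nu>'] by linarith
  qed

  obtain NA where NA: "finite NA" "NA \<subseteq> states eA"
    "\<And>\<mu>. \<mu> \<in> states eA \<Longrightarrow> \<exists>\<kappa>\<in>NA. state_dist LA \<kappa> \<mu> < \<eta>"
    by (rule states_finite_net[OF A \<eta>]) (rule that)
  obtain NB where NB: "finite NB" "NB \<subseteq> states eB"
    "\<And>\<nu>. \<nu> \<in> states eB \<Longrightarrow> \<exists>\<kappa>\<in>NB. state_dist LB \<kappa> \<nu> < \<eta>"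
    by (rule states_finite_net[OF B \<eta>]) (rule that)
  define J where "J = (NA \<times> NB) \<times> (NA \<times> NB)"
  have J: "finite J" "J \<subseteq> X" using NA(1,2) NB(1,2) by (auto simp: J_def X_def)
  obtain \<mu>0 \<nu>0 where base: "\<mu>0 \<in> states eA" "\<nu>0 \<in> states eB"
    using states_nonempty[OF A(1)] states_nonempty[OF B(1)] by blast
  then have "J \<noteq> {}" using NA(3)[OF base(1)] NB(3)[OF base(2)] by (auto simp: J_def)
  have "\<forall>x\<in>J. \<exists>b. LB b \<le> 1 \<and> F b x < \<eta>" using pointwise J(2) by blast
  then obtain \<beta> where \<beta>: "\<And>j. j \<in> J \<Longrightarrow> LB (\<beta> j) \<le> 1" "\<And>j. j \<in> J \<Longrightarrow> F (\<beta> j) j < \<eta>"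
    by (auto dest!: bchoice)

  have "\<exists>w. (\<forall>j\<in>J. 0 \<le> w j) \<and> sum w J = 1 \<and> (\<forall>x\<in>X. (\<Sum>j\<in>J. w j * (F (\<beta> j) x - \<epsilon>)) \<le> 0)"
  proof (rule finite_minimax[OF J(1) \<open>J \<noteq> {}\<close>])
    fix x y and t :: real
    assume x: "x \<in> X" and y: "y \<in> X" and t: "t \<in> {0..1}"
    obtain \<mu> \<nu> \<mu>' \<nu>' where x_eq: "x = ((\<mu>, \<nu>), (\<mu>', \<nu>'))"
      and sx: "\<mu> \<in> states eA" "\<nu> \<in> states eB" "\<mu>' \<in> states eA" "\<nu>' \<in> states eB"
      using x by (auto simp: X_def)
    obtain \<mu>1 \<nu>1 \<mu>1' \<nu>1' where y_eq: "y = ((\<mu>1, \<nu>1), (\<mu>1', \<nu>1'))"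
      and sy: "\<mu>1 \<in> states eA" "\<nu>1 \<in> states eB" "\<mu>1' \<in> states eA" "\<nu>1' \<in> states eB"
      using y by (auto simp: X_def)
    define z where "z = ((mix t \<mu> \<mu>1, mix t \<nu> \<nu>1), (mix t \<mu>' \<mu>1', mix t \<nu>' \<nu>1'))"
    have "z \<in> X"
      using sx sy t by (auto simp: X_def z_def intro!: states_convex[OF A(1)] states_convex[OF B(1)])
    moreover have "N (mix t \<mu> \<mu>1) (mix t \<nu> \<nu>1) \<le> (1 - t) * N \<mu> \<nu> + t * N \<mu>1 \<nu>1"
      "N (mix t \<mu>' \<mu>1') (mix t \<nu>' \<nu>1') \<le> (1 - t) * N \<mu>' \<nu>' + t * N \<mu>1' \<nu>1'"
      using N sx sy t unfolding bridge_def by blast+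
    then have "(1 - t) * (F b x - \<epsilon>) + t * (F b y - \<epsilon>) \<le> F b z - \<epsilon>" for b
      unfolding x_eq y_eq z_def F by (simp add: algebra_simps)
    ultimately show "\<exists>z\<in>X. \<forall>j\<in>J. (1 - t) * (F (\<beta> j) x - \<epsilon>) + t * (F (\<beta> j) y - \<epsilon>) \<le> F (\<beta> j) z - \<epsilon>"
      by blast
  next
    fix x assume x: "x \<in> X"
    obtain \<mu> \<nu> \<mu>' \<nu>' where x_eq: "x = ((\<mu>, \<nu>), (\<mu>', \<nu>'))"
      and st: "\<mu> \<in> states eA" "\<nu> \<in> states eB" "\<mu>' \<in> states eA" "\<nu>' \<in> states eB"
      using x by (auto simp: X_def)
    obtain \<mu>1 \<nu>1 \<mu>1' \<nu>1' where n: "\<mu>1 \<in> NA" "\<nu>1 \<in> NB" "\<mu>1' \<in> NA" "\<nu>1' \<in> NB"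
      and d: "state_dist LA \<mu>1 \<mu> < \<eta>" "state_dist LB \<nu>1 \<nu> < \<eta>"
        "state_dist LA \<mu>1' \<mu>' < \<eta>" "state_dist LB \<nu>1' \<nu>' < \<eta>"
      using NA(3)[OF st(1)] NB(3)[OF st(2)] NA(3)[OF st(3)] NB(3)[OF st(4)] by blast
    define j where "j = ((\<mu>1, \<nu>1), (\<mu>1', \<nu>1'))"
    have j: "j \<in> J" using n by (simp add: j_def J_def)
    have "F (\<beta> j) x < F (\<beta> j) j + 8 * \<eta>"
      unfolding x_eq j_def
      using NA(2) NB(2) n j by (intro lipschitz \<beta>(1)[OF j, unfolded j_def] st d) auto
    then have "F (\<beta> j) x - \<epsilon> < 0" using \<beta>(2)[OF j] by (simp add: \<eta>_def)
    then show "\<exists>j\<in>J. F (\<beta> j) x - \<epsilon> < 0" using j by blast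
  qed
  then obtain w where w: "\<And>j. j \<in> J \<Longrightarrow> 0 \<le> w j" "sum w J = 1"
    and w_le: "\<And>x. x \<in> X \<Longrightarrow> (\<Sum>j\<in>J. w j * (F (\<beta> j) x - \<epsilon>)) \<le> 0"
    by blast
  define b' where "b' = (\<Sum>j\<in>J. w j *\<^sub>R \<beta> j)"
  have "LB b' \<le> (\<Sum>j\<in>J. \<bar>w j\<bar> * LB (\<beta> j))"
    unfolding b'_def by (rule seminorm_sum_le[OF LB J(1)])
  also have "\<dots> \<le> (\<Sum>j\<in>J. w j * 1)"
    using w(1) \<beta>(1) by (intro sum_mono) (simp add: mult_left_mono mult_left_le)
  finally have Lb': "LB b' \<le> 1" using w(2) by simp
  have F_le: "F b' ((\<mu>, \<nu>), (\<mu>', \<nu>')) \<le> \<epsilon>"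
    if st: "\<mu> \<in> states eA" "\<nu> \<in> states eB" "\<mu>' \<in> states eA" "\<nu>' \<in> states eB" for \<mu> \<nu> \<mu>' \<nu>'
  proof -
    have eval: "\<kappa> b' = (\<Sum>j\<in>J. w j * \<kappa> (\<beta> j))" if "\<kappa> \<in> states eB" for \<kappa>
      using state_linear[OF B(1) that] by (simp add: b'_def linear_sum linear_cmul)
    have const: "c = (\<Sum>j\<in>J. w j * c)" for c
      using w(2) by (simp flip: sum_distrib_right)
    let ?c = "\<mu> a - \<mu>' a - N \<mu> \<nu> - N \<mu>' \<nu>' - \<epsilon>"
    have "F b' ((\<mu>, \<nu>), (\<mu>', \<nu>')) - \<epsilon> = ?c - (\<nu> b' - \<nu>' b')" by (simp add: F)
    also have "\<dots> = (\<Sum>j\<in>J. w j * ?c) - ((\<Sum>j\<in>J. w j * \<nu> (\<beta> j)) - (\<Sum>j\<in>J. w j * \<nu>' (\<beta> j)))"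
      using const[of ?c] eval st(2,4) by simp
    also have "\<dots> = (\<Sum>j\<in>J. w j * (F (\<beta> j) ((\<mu>, \<nu>), (\<mu>', \<nu>')) - \<epsilon>))"
      unfolding F by (simp add: sum_subtractf[symmetric] algebra_simps)
    also have "\<dots> \<le> 0" using st by (intro w_le) (simp add: X_def)
    finally show ?thesis by simp
  qed

  \<comment> \<open>What remains is a choice of the multiple of the unit. The lower bounds for it exceed the upper
    bounds by at most \<open>\<epsilon>\<close>, and \<open>c\<close> is the supremum of the lower ones.\<close>
  define c where "c = (SUP (\<mu>, \<nu>)\<in>states eA \<times> states eB. \<mu> a - \<nu> b' - N \<mu> \<nu>)"
  have sep: "\<mu> a - \<nu> b' - N \<mu> \<nu> \<le> \<mu>' a - \<nu>' b' + N \<mu>' \<nu>' + \<epsilon>"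
    if "\<mu> \<in> states eA" "\<nu> \<in> states eB" "\<mu>' \<in> states eA" "\<nu>' \<in> states eB" for \<mu> \<nu> \<mu>' \<nu>'
    using F_le[OF that] by (simp add: F)
  have "bdd_above ((\<lambda>(\<mu>, \<nu>). \<mu> a - \<nu> b' - N \<mu> \<nu>) ` (states eA \<times> states eB))"
    using sep[OF _ _ base] by (intro bdd_aboveI[of _ "\<mu>0 a - \<nu>0 b' + N \<mu>0 \<nu>0 + \<epsilon>"]) auto
  then have upper: "\<mu> a - \<nu> b' - N \<mu> \<nu> \<le> c" if "\<mu> \<in> states eA" "\<nu> \<in> states eB" for \<mu> \<nu>
    unfolding c_def using that cSUP_upper[of "(\<mu>, \<nu>)" "states eA \<times> states eB"] by fastforce
  have lower: "c \<le> \<mu> a - \<nu> b' + N \<mu> \<nu> + \<epsilon>" if "\<mu> \<in> states eA" "\<nu> \<in> states eB" for \<mu> \<nu>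
    unfolding c_def using sep[OF _ _ that] base by (intro cSUP_least) auto
  define b where "b = b' + c *\<^sub>R eB"
  show thesis
  proof (rule that)
    show "LB b \<le> 1" using Lb' lip_add_unit[OF B] by (simp add: b_def)
    fix \<mu> \<nu> assume st: "\<mu> \<in> states eA" "\<nu> \<in> states eB"
    have "\<nu> b = \<nu> b' + c"
      using state_linear[OF B(1) st(2)] state_unit[OF B(1) st(2)]
      by (simp add: b_def linear_add linear_cmul)
    then show "\<bar>\<mu> a - \<nu> b\<bar> \<le> N \<mu> \<nu> + \<epsilon>"
      using upper[OF st] lower[OF st] \<epsilon> by simp
  qed
qed

section \<open>The sum of two order-unit spaces\<close>

lemma scaleR_le_Pair_iff:
  "c \<le> r *\<^sub>R (eA, eB) \<longleftrightarrow> fst c \<le> r *\<^sub>R eA \<and> snd c \<le> r *\<^sub>R eB"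
  by (cases c) simp

lemma order_unit_space_Pair:
  assumes A: "order_unit_space eA" and B: "order_unit_space eB"
  shows "order_unit_space (eA, eB)"
  unfolding order_unit_space_def
proof (intro conjI allI impI)
  show "0 < (eA, eB)"
    using order_unit_pos[OF A] order_unit_pos[OF B] by (auto simp: less_prod_def less_eq_prod_def)
next
  fix c :: "'a \<times> 'b"
  obtain r s where "fst c \<le> r *\<^sub>R eA" "snd c \<le> s *\<^sub>R eB"
    using A B unfolding order_unit_space_def by blast
  moreover have "r *\<^sub>R eA \<le> max r s *\<^sub>R eA" "s *\<^sub>R eB \<le> max r s *\<^sub>R eB"
    by (simp_all add: scale_unit_le_iff[OF A] scale_unit_le_iff[OF B])
  ultimately show "\<exists>r. c \<le> r *\<^sub>R (eA, eB)"
    unfolding scaleR_le_Pair_iff by (meson order_trans)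
next
  fix c :: "'a \<times> 'b" assume c: "\<forall>r>0. c \<le> r *\<^sub>R (eA, eB)"
  have "fst c \<le> 0 *\<^sub>R eA"
    by (rule archimedean_order_unit[OF A]) (use c[unfolded scaleR_le_Pair_iff] in blast)
  moreover have "snd c \<le> 0 *\<^sub>R eB"
    by (rule archimedean_order_unit[OF B]) (use c[unfolded scaleR_le_Pair_iff] in blast)
  ultimately show "c \<le> 0" by (simp add: less_eq_prod_def)
qed

lemma linear_Pair_left: "linear (\<lambda>a. (a, 0))"
  and linear_Pair_right: "linear (\<lambda>b. (0, b))"
  by (simp_all add: linear_iff)

context
  fixes eA :: "'a::ordered_real_vector" and eB :: "'b::ordered_real_vector"
  assumes A: "order_unit_space eA" and B: "order_unit_space eB"
begin

lemma state_comp_fst: "\<mu> \<in> states eA \<Longrightarrow> \<mu> \<circ> fst \<in> states (eA, eB)"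
  by (rule stateI[OF order_unit_space_Pair[OF A B]])
    (simp_all add: linear_compose[OF linear_fst state_linear[OF A]] state_unit[OF A]
      state_nonneg[OF A] less_eq_prod_def)

lemma state_comp_snd: "\<nu> \<in> states eB \<Longrightarrow> \<nu> \<circ> snd \<in> states (eA, eB)"
  by (rule stateI[OF order_unit_space_Pair[OF A B]])
    (simp_all add: linear_compose[OF linear_snd state_linear[OF B]] state_unit[OF B]
      state_nonneg[OF B] less_eq_prod_def)

lemma state_Pair_decompose:
  assumes \<omega>: "\<omega> \<in> states (eA, eB)"
  obtains t \<mu> \<nu> where "t \<in> {0..1}" "\<mu> \<in> states eA" "\<nu> \<in> states eB"
    "\<And>a b. \<omega> (a, b) = t * \<mu> a + (1 - t) * \<nu> b"
proof -
  note AB = order_unit_space_Pair[OF A B]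
  note lin = state_linear[OF AB \<omega>]
  have pos: "0 \<le> \<omega> (a, 0)" "0 \<le> \<omega> (0, b)" if "a \<ge> 0" "b \<ge> 0" for a b
    using that by (auto intro!: state_nonneg[OF AB \<omega>] simp: less_eq_prod_def)
  have split: "\<omega> (a, b) = \<omega> (a, 0) + \<omega> (0, b)" for a b
    using linear_add[OF lin, of "(a, 0)" "(0, b)"] by simp
  have unit: "\<omega> (0, eB) = 1 - \<omega> (eA, 0)"
    using split[of eA eB] state_unit[OF AB \<omega>] by simp
  have "linear (\<lambda>a. \<omega> (a, 0))" "linear (\<lambda>b. \<omega> (0, b))"
    using linear_compose[OF linear_Pair_left lin] linear_compose[OF linear_Pair_right lin]
    by (simp_all add: o_def)
  note multiple = positive_functional_multiple_of_state[OF A this(1) _ states_nonempty[OF A]]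
    positive_functional_multiple_of_state[OF B this(2) _ states_nonempty[OF B]]
  obtain \<mu> where \<mu>: "\<mu> \<in> states eA" "\<And>a. \<omega> (a, 0) = \<omega> (eA, 0) * \<mu> a"
    by (rule multiple(1)) (rule pos(1)[OF _ order_refl], assumption, rule that)
  obtain \<nu> where \<nu>: "\<nu> \<in> states eB" "\<And>b. \<omega> (0, b) = \<omega> (0, eB) * \<nu> b"
    by (rule multiple(2)) (rule pos(2)[OF order_refl], assumption, rule that)
  have "\<omega> (eA, 0) \<in> {0..1}"
    using pos[of eA eB] order_unit_pos[OF A] order_unit_pos[OF B] unit by simp
  moreover have "\<omega> (a, b) = \<omega> (eA, 0) * \<mu> a + (1 - \<omega> (eA, 0)) * \<nu> b" for a b
    unfolding split[of a b] \<mu>(2)[of a] \<nu>(2)[of b] unit ..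
  ultimately show thesis using that \<mu>(1) \<nu>(1) by blast
qed

end

text \<open>
  If \<open>t = 0\<close> the weak-* closeness says nothing about \<open>\<mu>'\<close>, but then \<open>t'\<close> is small and the
  values of \<open>\<mu>'\<close> are uniformly bounded on the elements considered.
\<close>

lemma scaled_state_neighbourhood:
  assumes A: "order_unit_space e" "lip_norm e L" and \<mu>: "\<mu> \<in> states e" and t: "t \<in> {0..1}"
    and \<mu>\<^sub>0: "\<mu>\<^sub>0 \<in> states e" and C: "C \<ge> 0" and \<epsilon>: "\<epsilon> > 0"
  shows "\<exists>F \<delta>. finite F \<and> \<delta> > 0 \<and>
     (\<forall>\<mu>'\<in>states e. \<forall>t'\<in>{0..1}. \<bar>t - t'\<bar> < \<delta> \<longrightarrow> (\<forall>a\<in>F. \<bar>t * \<mu> a - t' * \<mu>' a\<bar> < \<delta>) \<longrightarrow>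
        (\<forall>a. L a \<le> 1 \<longrightarrow> \<bar>\<mu>\<^sub>0 a\<bar> \<le> C \<longrightarrow> \<bar>t * \<mu> a - t' * \<mu>' a\<bar> \<le> \<epsilon>))"
proof -
  obtain D where D: "D \<ge> 0"
    "\<And>\<mu> \<nu> a. \<mu> \<in> states e \<Longrightarrow> \<nu> \<in> states e \<Longrightarrow> L a \<le> 1 \<Longrightarrow> \<bar>\<mu> a - \<nu> a\<bar> \<le> D"
    by (rule state_diff_bounded[OF A]) (rule that)
  obtain F \<delta>\<^sub>0 where F: "finite F" "0 < \<delta>\<^sub>0"
    "\<And>\<nu>. \<nu> \<in> states e \<Longrightarrow> \<forall>a\<in>F. \<bar>\<mu> a - \<nu> a\<bar> < \<delta>\<^sub>0 \<Longrightarrow> rho L \<mu> \<nu> < ennreal (\<epsilon> / 2)"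
    by (rule lip_norm_neighbourhood[OF A \<mu>, of "\<epsilon> / 2"]) (use \<epsilon> in simp, rule that)
  define Q where "Q = 1 + (\<Sum>a\<in>F. ou_norm e a)"
  have Q: "ou_norm e a \<le> Q" if "a \<in> F" for a
    using member_le_sum[of a F "ou_norm e"] that F(1) ou_norm_nonneg[OF A(1)] by (simp add: Q_def)
  have "Q \<ge> 1" using ou_norm_nonneg[OF A(1)] by (simp add: Q_def sum_nonneg)
  define M where "M = C + D + 1"
  have "M > 0" using C D(1) by (simp add: M_def)
  \<comment> \<open>\<open>M\<close> bounds \<open>\<mu>' a\<close> for the elements considered, and \<open>Q\<close> bounds all states on \<open>F\<close>; the second
    bound is for passing from \<open>t \<mu> - t' \<mu>'\<close> to \<open>t (\<mu> - \<mu>')\<close> on \<open>F\<close>.\<close>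
  define \<delta> where "\<delta> = min (\<epsilon> / (2 * M)) (if t = 0 then 1 else t * \<delta>\<^sub>0 / (1 + Q))"
  have "\<delta> \<le> \<epsilon> / (2 * M)" "t \<noteq> 0 \<Longrightarrow> \<delta> \<le> t * \<delta>\<^sub>0 / (1 + Q)" by (simp_all add: \<delta>_def)
  then have \<delta>_le: "\<delta> * M \<le> \<epsilon> / 2" "t \<noteq> 0 \<Longrightarrow> \<delta> * (1 + Q) \<le> t * \<delta>\<^sub>0"
    using \<open>M > 0\<close> \<open>Q \<ge> 1\<close> by (simp_all add: pos_le_divide_eq mult_ac)
  have \<delta>: "\<delta> > 0"
    using \<epsilon> \<open>M > 0\<close> \<open>Q \<ge> 1\<close> F(2) t by (simp add: \<delta>_def)
  have "\<bar>t * \<mu> a - t' * \<mu>' a\<bar> \<le> \<epsilon>"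
    if \<mu>': "\<mu>' \<in> states e" and t': "t' \<in> {0..1}" "\<bar>t - t'\<bar> < \<delta>"
      and close: "\<forall>a\<in>F. \<bar>t * \<mu> a - t' * \<mu>' a\<bar> < \<delta>" and a: "L a \<le> 1" "\<bar>\<mu>\<^sub>0 a\<bar> \<le> C" for \<mu>' t' a
  proof -
    have decomp: "t * \<mu> c - t' * \<mu>' c = t * (\<mu> c - \<mu>' c) + (t - t') * \<mu>' c" for c
      by (simp add: algebra_simps)
    have "\<bar>\<mu>' a\<bar> \<le> M" using D(2)[OF \<mu>\<^sub>0 \<mu>' a(1)] a(2) by (simp add: M_def)
    then have "\<bar>(t - t') * \<mu>' a\<bar> \<le> \<delta> * M"
      using t'(2) by (simp add: abs_mult mult_mono)
    with \<delta>_le(1) have second: "\<bar>(t - t') * \<mu>' a\<bar> \<le> \<epsilon> / 2" by linarith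
    have first: "\<bar>t * (\<mu> a - \<mu>' a)\<bar> \<le> \<epsilon> / 2"
    proof (cases "t = 0")
      case False
      then have "t > 0" using t by simp
      have "\<bar>\<mu> c - \<mu>' c\<bar> < \<delta>\<^sub>0" if c: "c \<in> F" for c
      proof -
        have "\<bar>(t - t') * \<mu>' c\<bar> \<le> \<delta> * Q"
          using t'(2) state_bound[OF A(1) \<mu>', of c] Q[OF c] by (simp add: abs_mult mult_mono)
        then have "\<bar>t * (\<mu> c - \<mu>' c)\<bar> < \<delta> + \<delta> * Q"
          using bspec[OF close c] decomp[of c] by linarith
        also have "\<dots> \<le> t * \<delta>\<^sub>0" using \<delta>_le(2)[OF False] by (simp add: algebra_simps)
        finally show ?thesis using \<open>t > 0\<close> by (simp add: abs_mult)
      qed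
      then have "rho L \<mu> \<mu>' < ennreal (\<epsilon> / 2)" using F(3)[OF \<mu>'] by blast
      then have "\<bar>\<mu> a - \<mu>' a\<bar> \<le> \<epsilon> / 2"
        using rho_le_iff[of "\<epsilon> / 2" L \<mu> \<mu>'] a(1) \<epsilon> by (simp add: less_imp_le)
      then have "t * \<bar>\<mu> a - \<mu>' a\<bar> \<le> 1 * (\<epsilon> / 2)"
        using t by (intro mult_mono) auto
      then show ?thesis using \<open>t > 0\<close> by (simp add: abs_mult)
    qed (use \<epsilon> in simp)
    show ?thesis using decomp[of a] first second by linarith
  qed
  then show ?thesis using F(1) \<delta> by blast
qed

section \<open>The Lip-norm of a bridge\<close>

text \<open>
  The third term forces \<open>\<rho>\<close>, computed between a state of the first and a state of the second
  summand, to be at most \<open>N + \<epsilon>\<close>. The \<open>\<epsilon>\<close> keeps it finite where the images of the state spaces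
  meet, that is, where \<open>N\<close> vanishes.
\<close>

definition bridge_norm ::
  "'a::ordered_real_vector \<Rightarrow> ('a \<Rightarrow> real) \<Rightarrow> 'b::ordered_real_vector \<Rightarrow> ('b \<Rightarrow> real) \<Rightarrow>
   (('a \<Rightarrow> real) \<Rightarrow> ('b \<Rightarrow> real) \<Rightarrow> real) \<Rightarrow> real \<Rightarrow> 'a \<times> 'b \<Rightarrow> real" where
  "bridge_norm eA LA eB LB N \<epsilon> = (\<lambda>(a, b). max (max (LA a) (LB b))
     (SUP (\<mu>, \<nu>)\<in>states eA \<times> states eB. \<bar>\<mu> a - \<nu> b\<bar> / (N \<mu> \<nu> + \<epsilon>)))"

context
  fixes eA :: "'a::ordered_real_vector" and LA and eB :: "'b::ordered_real_vector" and LB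
    and N :: "('a \<Rightarrow> real) \<Rightarrow> ('b \<Rightarrow> real) \<Rightarrow> real" and \<epsilon> :: real
  assumes A: "order_unit_space eA" "lip_norm eA LA" and B: "order_unit_space eB" "lip_norm eB LB"
    and N: "bridge eA LA eB LB N" and \<epsilon>: "\<epsilon> > 0"
begin

lemma bridge_nonneg: "\<mu> \<in> states eA \<Longrightarrow> \<nu> \<in> states eB \<Longrightarrow> 0 \<le> N \<mu> \<nu>"
  using N by (simp add: bridge_def)

lemma bridge_norm_le_iff:
  "bridge_norm eA LA eB LB N \<epsilon> (a, b) \<le> c \<longleftrightarrow>
     LA a \<le> c \<and> LB b \<le> c \<and>
     (\<forall>\<mu>\<in>states eA. \<forall>\<nu>\<in>states eB. \<bar>\<mu> a - \<nu> b\<bar> \<le> c * (N \<mu> \<nu> + \<epsilon>))"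
proof -
  have bdd: "bdd_above ((\<lambda>(\<mu>, \<nu>). \<bar>\<mu> a - \<nu> b\<bar> / (N \<mu> \<nu> + \<epsilon>)) ` (states eA \<times> states eB))"
  proof (rule bdd_aboveI)
    fix x assume "x \<in> (\<lambda>(\<mu>, \<nu>). \<bar>\<mu> a - \<nu> b\<bar> / (N \<mu> \<nu> + \<epsilon>)) ` (states eA \<times> states eB)"
    then obtain \<mu> \<nu> where st: "\<mu> \<in> states eA" "\<nu> \<in> states eB"
      and x: "x = \<bar>\<mu> a - \<nu> b\<bar> / (N \<mu> \<nu> + \<epsilon>)" by auto
    have "\<bar>\<mu> a - \<nu> b\<bar> \<le> ou_norm eA a + ou_norm eB b"
      using state_bound[OF A(1) st(1), of a] state_bound[OF B(1) st(2), of b] by linarith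
    then show "x \<le> (ou_norm eA a + ou_norm eB b) / \<epsilon>"
      unfolding x using \<epsilon> bridge_nonneg[OF st] by (intro frac_le) auto
  qed
  have "states eA \<times> states eB \<noteq> {}"
    using states_nonempty[OF A(1)] states_nonempty[OF B(1)] by simp
  then have "(SUP (\<mu>, \<nu>)\<in>states eA \<times> states eB. \<bar>\<mu> a - \<nu> b\<bar> / (N \<mu> \<nu> + \<epsilon>)) \<le> c \<longleftrightarrow>
      (\<forall>\<mu>\<in>states eA. \<forall>\<nu>\<in>states eB. \<bar>\<mu> a - \<nu> b\<bar> / (N \<mu> \<nu> + \<epsilon>) \<le> c)"
    using cSUP_le_iff[OF _ bdd] by auto
  also have "\<dots> \<longleftrightarrow> (\<forall>\<mu>\<in>states eA. \<forall>\<nu>\<in>states eB. \<bar>\<mu> a - \<nu> b\<bar> \<le> c * (N \<mu> \<nu> + \<epsilon>))"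
    using bridge_nonneg \<epsilon> by (intro ball_cong refl pos_divide_le_eq) (simp add: add_nonneg_pos)
  finally show ?thesis by (simp add: bridge_norm_def conj_assoc)
qed

lemma
  shows LA_le_bridge_norm: "LA a \<le> bridge_norm eA LA eB LB N \<epsilon> (a, b)"
    and LB_le_bridge_norm: "LB b \<le> bridge_norm eA LA eB LB N \<epsilon> (a, b)"
    and state_diff_le_bridge_norm: "\<mu> \<in> states eA \<Longrightarrow> \<nu> \<in> states eB \<Longrightarrow>
      \<bar>\<mu> a - \<nu> b\<bar> \<le> bridge_norm eA LA eB LB N \<epsilon> (a, b) * (N \<mu> \<nu> + \<epsilon>)"
  using iffD1[OF bridge_norm_le_iff order_refl, of a b] by simp_all

lemma seminorm_bridge_norm: "seminorm (bridge_norm eA LA eB LB N \<epsilon>)" (is "seminorm ?L")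
proof -
  have nonneg: "0 \<le> ?L c" for c
    using LA_le_bridge_norm[of "fst c" "snd c"] seminorm_nonneg[OF lip_seminorm[OF A], of "fst c"]
    by simp
  have scale: "?L (r *\<^sub>R c) \<le> \<bar>r\<bar> * ?L c" for r c
  proof (cases c)
    case (Pair a b)
    have "\<bar>\<mu> (r *\<^sub>R a) - \<nu> (r *\<^sub>R b)\<bar> \<le> \<bar>r\<bar> * ?L (a, b) * (N \<mu> \<nu> + \<epsilon>)"
      if st: "\<mu> \<in> states eA" "\<nu> \<in> states eB" for \<mu> \<nu>
    proof -
      have "\<mu> (r *\<^sub>R a) - \<nu> (r *\<^sub>R b) = r * (\<mu> a - \<nu> b)"
        using linear_cmul[OF state_linear[OF A(1) st(1)]] linear_cmul[OF state_linear[OF B(1) st(2)]]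
        by (simp add: right_diff_distrib)
      then show ?thesis
        using mult_left_mono[OF state_diff_le_bridge_norm[OF st, of a b], of "\<bar>r\<bar>"]
        by (simp add: abs_mult mult.assoc)
    qed
    then show ?thesis
      using LA_le_bridge_norm[of a b] LB_le_bridge_norm[of b a]
      by (simp add: Pair bridge_norm_le_iff mult_left_mono
          seminorm_scale[OF lip_seminorm[OF A]] seminorm_scale[OF lip_seminorm[OF B]])
  qed
  have "?L (r *\<^sub>R c) = \<bar>r\<bar> * ?L c" for r c
  proof (cases "r = 0")
    case True
    then show ?thesis using scale[of r c] nonneg[of "r *\<^sub>R c"] by simp
  next
    case False
    then have "?L c \<le> \<bar>inverse r\<bar> * ?L (r *\<^sub>R c)"
      using scale[of "inverse r" "r *\<^sub>R c"] by simp
    then show ?thesis using scale[of r c] False by (simp add: field_simps)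
  qed
  moreover have "?L (c + d) \<le> ?L c + ?L d" for c d
  proof (cases c, cases d)
    fix a b a' b' assume cd: "c = (a, b)" "d = (a', b')"
    have "\<bar>\<mu> (a + a') - \<nu> (b + b')\<bar> \<le> (?L (a, b) + ?L (a', b')) * (N \<mu> \<nu> + \<epsilon>)"
      if st: "\<mu> \<in> states eA" "\<nu> \<in> states eB" for \<mu> \<nu>
      using state_diff_le_bridge_norm[OF st, of a b] state_diff_le_bridge_norm[OF st, of a' b']
        linear_add[OF state_linear[OF A(1) st(1)], of a a']
        linear_add[OF state_linear[OF B(1) st(2)], of b b']
      unfolding distrib_right[of "?L (a, b)"] by linarith
    moreover have "LA (a + a') \<le> ?L (a, b) + ?L (a', b')" "LB (b + b') \<le> ?L (a, b) + ?L (a', b')"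
      using seminorm_add[OF lip_seminorm[OF A], of a a'] seminorm_add[OF lip_seminorm[OF B], of b b']
        LA_le_bridge_norm[of a b] LA_le_bridge_norm[of a' b'] LB_le_bridge_norm[of b a]
        LB_le_bridge_norm[of b' a']
      by linarith+
    ultimately show ?thesis by (simp add: cd bridge_norm_le_iff)
  qed
  ultimately show ?thesis using nonneg by (simp add: seminorm_def)
qed

lemma bridge_norm_kernel:
  "bridge_norm eA LA eB LB N \<epsilon> c = 0 \<longleftrightarrow> c \<in> range (\<lambda>r::real. r *\<^sub>R (eA, eB))" (is "?L c = 0 \<longleftrightarrow> _")
proof (cases c)
  case (Pair a b)
  have "?L c = 0 \<longleftrightarrow> ?L c \<le> 0"
    using seminorm_nonneg[OF seminorm_bridge_norm, of c] by auto
  also have "\<dots> \<longleftrightarrow> LA a = 0 \<and> LB b = 0 \<and> (\<forall>\<mu>\<in>states eA. \<forall>\<nu>\<in>states eB. \<mu> a = \<nu> b)"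
    using seminorm_nonneg[OF lip_seminorm[OF A], of a] seminorm_nonneg[OF lip_seminorm[OF B], of b]
    by (auto simp: Pair bridge_norm_le_iff)
  also have "\<dots> \<longleftrightarrow> (\<exists>r s. a = r *\<^sub>R eA \<and> b = s *\<^sub>R eB \<and>
      (\<forall>\<mu>\<in>states eA. \<forall>\<nu>\<in>states eB. \<mu> a = \<nu> b))"
    using lip_kernel[OF A] lip_kernel[OF B] by auto
  also have "\<dots> \<longleftrightarrow> (\<exists>r. a = r *\<^sub>R eA \<and> b = r *\<^sub>R eB)"
  proof -
    have eq: "(\<forall>\<mu>\<in>states eA. \<forall>\<nu>\<in>states eB. \<mu> (r *\<^sub>R eA) = \<nu> (s *\<^sub>R eB)) \<longleftrightarrow> r = s" for r s
      using states_nonempty[OF A(1)] states_nonempty[OF B(1)]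
      by (simp add: state_scale_unit[OF A(1)] state_scale_unit[OF B(1)] cong: ball_cong_simp) blast
    show ?thesis
    proof
      assume "\<exists>r s. a = r *\<^sub>R eA \<and> b = s *\<^sub>R eB \<and> (\<forall>\<mu>\<in>states eA. \<forall>\<nu>\<in>states eB. \<mu> a = \<nu> b)"
      then obtain r s where rs: "a = r *\<^sub>R eA" "b = s *\<^sub>R eB"
        "\<forall>\<mu>\<in>states eA. \<forall>\<nu>\<in>states eB. \<mu> a = \<nu> b" by (elim exE conjE)
      then have "r = s" using eq[of r s] by (simp only:)
      then show "\<exists>r. a = r *\<^sub>R eA \<and> b = r *\<^sub>R eB" using rs(1,2) by blast
    next
      assume "\<exists>r. a = r *\<^sub>R eA \<and> b = r *\<^sub>R eB"
      then obtain r where r: "a = r *\<^sub>R eA" "b = r *\<^sub>R eB" by (elim exE conjE)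
      then have "\<forall>\<mu>\<in>states eA. \<forall>\<nu>\<in>states eB. \<mu> a = \<nu> b" using eq[of r r] by (simp only:)
      then show "\<exists>r s. a = r *\<^sub>R eA \<and> b = s *\<^sub>R eB \<and>
          (\<forall>\<mu>\<in>states eA. \<forall>\<nu>\<in>states eB. \<mu> a = \<nu> b)"
        using r by (intro exI conjI)
    qed
  qed
  also have "\<dots> \<longleftrightarrow> c \<in> range (\<lambda>r::real. r *\<^sub>R (eA, eB))" 
    by (simp only: Pair image_iff scaleR_Pair prod.inject UNIV_I Bex_def simp_thms)
  finally show ?thesis .
qed

text \<open>
  States \<open>\<omega> = t \<mu> \<circ> fst + (1 - t) \<nu> \<circ> snd\<close> are compared summand by summand. Subtracting a multiple
  of the unit from \<open>(a, b)\<close> makes \<open>\<mu>\<^sub>0 a = 0\<close>, and the third term of the seminorm then bounds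
  \<open>\<nu>\<^sub>0 b\<close>.
\<close>

lemma lip_norm_bridge_norm: "lip_norm (eA, eB) (bridge_norm eA LA eB LB N \<epsilon>)" (is "lip_norm _ ?L")
proof -
  note AB = order_unit_space_Pair[OF A(1) B(1)]
  obtain \<mu>\<^sub>0 \<nu>\<^sub>0 where base: "\<mu>\<^sub>0 \<in> states eA" "\<nu>\<^sub>0 \<in> states eB"
    using states_nonempty[OF A(1)] states_nonempty[OF B(1)] by blast
  define C where "C = N \<mu>\<^sub>0 \<nu>\<^sub>0 + \<epsilon>"
  have C: "C \<ge> 0" using bridge_nonneg[OF base] \<epsilon> by (simp add: C_def)
  have "\<exists>F \<delta>. finite F \<and> 0 < \<delta> \<and>
      (\<forall>\<omega>'\<in>states (eA, eB). (\<forall>c\<in>F. \<bar>\<omega> c - \<omega>' c\<bar> < \<delta>) \<longrightarrow> rho ?L \<omega> \<omega>' < ennreal \<eta>)"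
    if \<omega>: "\<omega> \<in> states (eA, eB)" and \<eta>: "\<eta> > 0" for \<omega> \<eta>
  proof -
    obtain t \<mu> \<nu> where t: "t \<in> {0..1}" and st: "\<mu> \<in> states eA" "\<nu> \<in> states eB"
      and \<omega>_eq: "\<And>a b. \<omega> (a, b) = t * \<mu> a + (1 - t) * \<nu> b"
      by (rule state_Pair_decompose[OF A(1) B(1) \<omega>]) (rule that)
    have t': "1 - t \<in> {0..1}" and "\<eta> / 3 > 0" using t \<eta> by auto
    obtain FA \<delta>A where FA: "finite FA" "\<delta>A > 0"
      "\<forall>\<mu>'\<in>states eA. \<forall>t'\<in>{0..1}. \<bar>t - t'\<bar> < \<delta>A \<longrightarrow>
        (\<forall>a\<in>FA. \<bar>t * \<mu> a - t' * \<mu>' a\<bar> < \<delta>A) \<longrightarrow>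
        (\<forall>a. LA a \<le> 1 \<longrightarrow> \<bar>\<mu>\<^sub>0 a\<bar> \<le> C \<longrightarrow> \<bar>t * \<mu> a - t' * \<mu>' a\<bar> \<le> \<eta> / 3)"
      using scaled_state_neighbourhood[OF A st(1) t base(1) C \<open>\<eta> / 3 > 0\<close>]
      by (elim exE conjE) (rule that)
    obtain FB \<delta>B where FB: "finite FB" "\<delta>B > 0"
      "\<forall>\<nu>'\<in>states eB. \<forall>t'\<in>{0..1}. \<bar>1 - t - t'\<bar> < \<delta>B \<longrightarrow>
        (\<forall>b\<in>FB. \<bar>(1 - t) * \<nu> b - t' * \<nu>' b\<bar> < \<delta>B) \<longrightarrow>
        (\<forall>b. LB b \<le> 1 \<longrightarrow> \<bar>\<nu>\<^sub>0 b\<bar> \<le> C \<longrightarrow> \<bar>(1 - t) * \<nu> b - t' * \<nu>' b\<bar> \<le> \<eta> / 3)"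
      using scaled_state_neighbourhood[OF B st(2) t' base(2) C \<open>\<eta> / 3 > 0\<close>]
      by (elim exE conjE) (rule that)
    define F where "F = {(eA, 0)} \<union> (\<lambda>a. (a, 0)) ` FA \<union> (\<lambda>b. (0, b)) ` FB"
    have "rho ?L \<omega> \<omega>' < ennreal \<eta>"
      if \<omega>': "\<omega>' \<in> states (eA, eB)" and close: "\<forall>c\<in>F. \<bar>\<omega> c - \<omega>' c\<bar> < min \<delta>A \<delta>B" for \<omega>'
    proof -
      obtain t' \<mu>' \<nu>' where t': "t' \<in> {0..1}" and st': "\<mu>' \<in> states eA" "\<nu>' \<in> states eB"
        and \<omega>'_eq: "\<And>a b. \<omega>' (a, b) = t' * \<mu>' a + (1 - t') * \<nu>' b"
        by (rule state_Pair_decompose[OF A(1) B(1) \<omega>']) (rule that)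
      note zero = linear_0[OF state_linear[OF A(1) st(1)]] linear_0[OF state_linear[OF A(1) st'(1)]]
        linear_0[OF state_linear[OF B(1) st(2)]] linear_0[OF state_linear[OF B(1) st'(2)]]
      have tt: "\<bar>t - t'\<bar> < \<delta>A" "\<bar>1 - t - (1 - t')\<bar> < \<delta>B"
        using close
        by (simp_all add: F_def \<omega>_eq \<omega>'_eq zero state_unit[OF A(1)] st st' abs_minus_commute)
      have closeA: "\<forall>a\<in>FA. \<bar>t * \<mu> a - t' * \<mu>' a\<bar> < \<delta>A"
        using close by (simp add: F_def \<omega>_eq \<omega>'_eq zero ball_Un)
      have closeB: "\<forall>b\<in>FB. \<bar>(1 - t) * \<nu> b - (1 - t') * \<nu>' b\<bar> < \<delta>B"
        using close by (simp add: F_def \<omega>_eq \<omega>'_eq zero ball_Un)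
      have "\<bar>\<omega> c - \<omega>' c\<bar> \<le> 2 * \<eta> / 3" if c: "?L c \<le> 1" for c
      proof -
        define r where "r = - \<mu>\<^sub>0 (fst c)"
        define a b where "a = fst c + r *\<^sub>R eA" and "b = snd c + r *\<^sub>R eB"
        have ab: "(a, b) = c + r *\<^sub>R (eA, eB)" by (simp add: a_def b_def prod_eq_iff)
        have "?L (a, b) \<le> ?L c + ?L (r *\<^sub>R (eA, eB))"
          unfolding ab by (rule seminorm_add[OF seminorm_bridge_norm])
        also have "?L (r *\<^sub>R (eA, eB)) = 0" using bridge_norm_kernel by blast
        finally have Lab: "LA a \<le> 1" "LB b \<le> 1" "\<bar>\<mu>\<^sub>0 a - \<nu>\<^sub>0 b\<bar> \<le> C"
          using c bridge_norm_le_iff[of a b 1] base by (auto simp: C_def)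
        have \<mu>\<^sub>0a: "\<mu>\<^sub>0 a = 0"
          by (simp add: a_def r_def linear_diff[OF state_linear[OF A(1) base(1)]]
              state_scale_unit[OF A(1) base(1)])
        have "\<omega> (a, b) = \<omega> c + r" "\<omega>' (a, b) = \<omega>' c + r"
          unfolding ab linear_add[OF state_linear[OF AB \<omega>]] linear_add[OF state_linear[OF AB \<omega>']]
            state_scale_unit[OF AB \<omega>] state_scale_unit[OF AB \<omega>'] by (rule refl)+
        then have "\<bar>\<omega> c - \<omega>' c\<bar> = \<bar>\<omega> (a, b) - \<omega>' (a, b)\<bar>" by simp
        also have "\<dots> \<le> \<bar>t * \<mu> a - t' * \<mu>' a\<bar> + \<bar>(1 - t) * \<nu> b - (1 - t') * \<nu>' b\<bar>"
          by (simp add: \<omega>_eq \<omega>'_eq)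
        also have "\<dots> \<le> \<eta> / 3 + \<eta> / 3"
        proof (rule add_mono)
          have "\<bar>\<mu>\<^sub>0 a\<bar> \<le> C" "\<bar>\<nu>\<^sub>0 b\<bar> \<le> C" using Lab(3) C by (simp_all add: \<mu>\<^sub>0a)
          moreover have "1 - t' \<in> {0..1}" using t' by simp
          ultimately show "\<bar>t * \<mu> a - t' * \<mu>' a\<bar> \<le> \<eta> / 3"
            "\<bar>(1 - t) * \<nu> b - (1 - t') * \<nu>' b\<bar> \<le> \<eta> / 3"
            using FA(3) FB(3) st' t' tt closeA closeB Lab(1,2) by blast+
        qed
        finally show ?thesis by simp
      qed
      then have "rho ?L \<omega> \<omega>' \<le> ennreal (2 * \<eta> / 3)"
        using \<eta> by (simp add: rho_le_iff)
      also have "\<dots> < ennreal \<eta>" using \<eta> by (simp add: ennreal_less_iff)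
      finally show ?thesis .
    qed
    moreover have "finite F" "min \<delta>A \<delta>B > 0" using FA FB by (auto simp: F_def)
    ultimately show ?thesis by (intro exI[of _ F] exI[of _ "min \<delta>A \<delta>B"]) blast
  qed
  then show ?thesis
    unfolding lip_norm_iff[OF AB seminorm_bridge_norm bridge_norm_kernel]
    by (intro ballI allI impI)
qed

text \<open>
  Every \<open>a\<close> with \<open>LA a \<le> 1\<close> has a partner \<open>b\<close> for which \<open>(a, b)\<close> lies in the unit ball, so, by
  scaling, the infimum over the fibre is attained.
\<close>

lemma quotient_seminorm_fst_bridge_norm:
  "quotient_seminorm fst (bridge_norm eA LA eB LB N \<epsilon>) = LA" (is "quotient_seminorm _ ?L = _")
proof
  fix a
  note LA = lip_seminorm[OF A] and LB = lip_seminorm[OF B]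
  have "\<exists>b. ?L (a, b) \<le> LA a"
  proof (cases "LA a = 0")
    case True
    then obtain r :: real where "a = r *\<^sub>R eA" 
      using lip_kernel[OF A, of a] by auto
    then have "(a, r *\<^sub>R eB) = r *\<^sub>R (eA, eB)" by simp
    then have "?L (a, r *\<^sub>R eB) = 0" using bridge_norm_kernel by blast
    then show ?thesis using True by (intro exI[of _ "r *\<^sub>R eB"]) simp
  next
    case False
    then have pos: "LA a > 0" using seminorm_nonneg[OF LA, of a] by simp
    then have "LA (inverse (LA a) *\<^sub>R a) \<le> 1" by (simp add: seminorm_scale[OF LA])
    then obtain b where "LB b \<le> 1"
      "\<And>\<mu> \<nu>. \<mu> \<in> states eA \<Longrightarrow> \<nu> \<in> states eB \<Longrightarrow>
        \<bar>\<mu> (inverse (LA a) *\<^sub>R a) - \<nu> b\<bar> \<le> N \<mu> \<nu> + \<epsilon>"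
      by (rule bridge_partner[OF A B N \<epsilon>]) (rule that)
    then have "?L (inverse (LA a) *\<^sub>R a, b) \<le> 1"
      using pos by (simp add: bridge_norm_le_iff seminorm_scale[OF LA])
    then have "LA a * ?L (inverse (LA a) *\<^sub>R a, b) \<le> LA a" using pos by simp
    moreover have "?L (LA a *\<^sub>R (inverse (LA a) *\<^sub>R a, b)) = LA a * ?L (inverse (LA a) *\<^sub>R a, b)"
      using pos by (simp only: seminorm_scale[OF seminorm_bridge_norm] abs_of_pos)
    ultimately have "?L (a, LA a *\<^sub>R b) \<le> LA a" using pos by simp
    then show ?thesis by blast
  qed
  then obtain b where "?L (a, b) \<le> LA a" by (elim exE)
  then have "?L (a, b) = LA a" using LA_le_bridge_norm[of a b] by simp
  show "quotient_seminorm fst ?L a = LA a"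
    unfolding quotient_seminorm_def
  proof (rule cInf_eq_minimum)
    show "LA a \<in> {?L c |c. fst c = a}"
      using \<open>?L (a, b) = LA a\<close> by (intro CollectI exI[of _ "(a, b)"]) simp
    show "LA a \<le> x" if "x \<in> {?L c |c. fst c = a}" for x
      using that LA_le_bridge_norm by auto
  qed
qed

lemma bridge_norm_swap:
  "bridge_norm eB LB eA LA (\<lambda>\<nu> \<mu>. N \<mu> \<nu>) \<epsilon> (b, a) = bridge_norm eA LA eB LB N \<epsilon> (a, b)"
proof -
  have "(\<lambda>(\<nu>, \<mu>). \<bar>\<nu> b - \<mu> a\<bar> / (N \<mu> \<nu> + \<epsilon>)) ` prod.swap ` (states eA \<times> states eB) =
      (\<lambda>(\<mu>, \<nu>). \<bar>\<mu> a - \<nu> b\<bar> / (N \<mu> \<nu> + \<epsilon>)) ` (states eA \<times> states eB)"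
    by (simp add: image_image case_prod_unfold abs_minus_commute)
  then show ?thesis
    by (simp add: bridge_norm_def max.commute product_swap)
qed

end

lemma quotient_seminorm_snd_bridge_norm:
  fixes eA :: "'a::ordered_real_vector" and eB :: "'b::ordered_real_vector"
  assumes A: "order_unit_space eA" "lip_norm eA LA" and B: "order_unit_space eB" "lip_norm eB LB"
    and N: "bridge eA LA eB LB N" and \<epsilon>: "\<epsilon> > 0"
  shows "quotient_seminorm snd (bridge_norm eA LA eB LB N \<epsilon>) = LB"
proof -
  have snd: "{L c |c. snd c = b} = range (\<lambda>a. L (a, b))" for L :: "'a \<times> 'b \<Rightarrow> real" and b
    by force
  have fst: "{L c |c. fst c = b} = range (\<lambda>a. L (b, a))" for L :: "'b \<times> 'a \<Rightarrow> real" and b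
    by force
  have "quotient_seminorm snd (bridge_norm eA LA eB LB N \<epsilon>) =
      quotient_seminorm fst (bridge_norm eB LB eA LA (\<lambda>\<nu> \<mu>. N \<mu> \<nu>) \<epsilon>)"
    by (intro ext) (simp only: quotient_seminorm_def snd fst bridge_norm_swap[OF A B N \<epsilon>])
  then show ?thesis
    by (simp add: quotient_seminorm_fst_bridge_norm[OF B A bridge_commute[OF N] \<epsilon>])
qed

lemma SUP_INF_le_add_const:
  fixes f g :: "'x \<Rightarrow> 'y \<Rightarrow> ennreal"
  assumes "\<And>x y. x \<in> X \<Longrightarrow> y \<in> Y \<Longrightarrow> f x y \<le> g x y + c"
  shows "(SUP x\<in>X. INF y\<in>Y. f x y) \<le> (SUP x\<in>X. INF y\<in>Y. g x y) + c"
proof (cases "Y = {} \<or> c = top")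
  case True
  then show ?thesis by (cases "X = {}") auto
next
  case False
  show ?thesis
  proof (rule SUP_least)
    fix x assume x: "x \<in> X"
    have "(INF y\<in>Y. f x y) - c \<le> (INF y\<in>Y. g x y)"
    proof (rule INF_greatest)
      fix y assume y: "y \<in> Y"
      have "(INF y\<in>Y. f x y) \<le> g x y + c"
        using INF_lower[OF y, of "f x"] assms[OF x y] by (rule order_trans)
      then show "(INF y\<in>Y. f x y) - c \<le> g x y"
        using False by (simp add: ennreal_minus_le_iff add.commute)
    qed
    also have "\<dots> \<le> (SUP x\<in>X. INF y\<in>Y. g x y)" by (rule SUP_upper[OF x])
    finally show "(INF y\<in>Y. f x y) \<le> (SUP x\<in>X. INF y\<in>Y. g x y) + c"
      using False by (simp add: ennreal_minus_le_iff add.commute)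
  qed
qed

lemma dist_q_le_bridge:
  assumes A: "order_unit_space eA" "lip_norm eA LA" and B: "order_unit_space eB" "lip_norm eB LB"
    and N: "bridge eA LA eB LB N"
  shows "dist_q eA LA eB LB \<le>
     max (SUP \<mu>\<in>states eA. INF \<nu>\<in>states eB. ennreal (N \<mu> \<nu>))
       (SUP \<nu>\<in>states eB. INF \<mu>\<in>states eA. ennreal (N \<mu> \<nu>))" (is "_ \<le> ?R")
proof (rule ennreal_le_epsilon)
  fix \<epsilon> :: real assume \<epsilon>: "\<epsilon> > 0"
  define L where "L = bridge_norm eA LA eB LB N \<epsilon>"
  have "admissible eA LA eB LB L"
    unfolding admissible_def L_def
    using lip_norm_bridge_norm[OF A B N \<epsilon>] quotient_seminorm_fst_bridge_norm[OF A B N \<epsilon>]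
      quotient_seminorm_snd_bridge_norm[OF A B N \<epsilon>] by blast
  then have "dist_q eA LA eB LB \<le>
      hausdorff_dist (rho L) ((\<lambda>\<mu>. \<mu> \<circ> fst) ` states eA) ((\<lambda>\<nu>. \<nu> \<circ> snd) ` states eB)"
    unfolding dist_q_def by (intro Inf_lower) blast
  also have "\<dots> = max (SUP \<mu>\<in>states eA. INF \<nu>\<in>states eB. rho L (\<mu> \<circ> fst) (\<nu> \<circ> snd))
      (SUP \<nu>\<in>states eB. INF \<mu>\<in>states eA. rho L (\<mu> \<circ> fst) (\<nu> \<circ> snd))"
    by (simp add: hausdorff_dist_def image_image)
  also have "\<dots> \<le> ?R + ennreal \<epsilon>"
  proof -
    have rho: "rho L (\<mu> \<circ> fst) (\<nu> \<circ> snd) \<le> ennreal (N \<mu> \<nu>) + ennreal \<epsilon>"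
      if st: "\<mu> \<in> states eA" "\<nu> \<in> states eB" for \<mu> \<nu>
    proof -
      have "rho L (\<mu> \<circ> fst) (\<nu> \<circ> snd) \<le> ennreal (N \<mu> \<nu> + \<epsilon>)"
        using bridge_norm_le_iff[OF A B N \<epsilon>, of _ _ 1] st bridge_nonneg[OF A B N \<epsilon> st] \<epsilon>
        by (subst rho_le_iff) (auto simp: L_def)
      then show ?thesis using bridge_nonneg[OF A B N \<epsilon> st] \<epsilon> by simp
    qed
    have "(SUP \<mu>\<in>states eA. INF \<nu>\<in>states eB. rho L (\<mu> \<circ> fst) (\<nu> \<circ> snd)) \<le>
        (SUP \<mu>\<in>states eA. INF \<nu>\<in>states eB. ennreal (N \<mu> \<nu>)) + ennreal \<epsilon>"
      using rho by (intro SUP_INF_le_add_const)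
    moreover have "(SUP \<nu>\<in>states eB. INF \<mu>\<in>states eA. rho L (\<mu> \<circ> fst) (\<nu> \<circ> snd)) \<le>
        (SUP \<nu>\<in>states eB. INF \<mu>\<in>states eA. ennreal (N \<mu> \<nu>)) + ennreal \<epsilon>"
      using rho by (intro SUP_INF_le_add_const)
    ultimately show ?thesis
      by (intro max.boundedI)
        (erule order_trans[OF _ add_right_mono[OF max.cobounded1]]
          order_trans[OF _ add_right_mono[OF max.cobounded2]])+
  qed
  finally show "dist_q eA LA eB LB \<le> ?R + ennreal \<epsilon>" .
qed

section \<open>From embeddings to bridges\<close>

context real_normed_space
begin

abbreviation diffv :: "'v \<Rightarrow> 'v \<Rightarrow> 'v" where
  "diffv x y \<equiv> addv V x (scalev V (- 1) y)"

lemma scale_zero: "x \<in> points V \<Longrightarrow> scalev V 0 x = zerov V"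
  using norm_scale[of x 0] norm_eq_zero[OF scale_closed[of x 0]] by simp

lemma diff_self: "x \<in> points V \<Longrightarrow> diffv x x = zerov V"
  using scale_add_left[of x 1 "- 1"] by (simp add: scale_zero scale_one)

lemma add_swap_middle:
  assumes "x \<in> points V" "y \<in> points V" "z \<in> points V" "w \<in> points V"
  shows "addv V (addv V x y) (addv V z w) = addv V (addv V x z) (addv V y w)"
proof -
  have "addv V (addv V x y) (addv V z w) = addv V x (addv V (addv V y z) w)"
    using assms by (simp add: add_assoc add_closed)
  also have "\<dots> = addv V x (addv V (addv V z y) w)"
    using assms by (simp add: add_commute[of y z])
  also have "\<dots> = addv V (addv V x z) (addv V y w)"
    using assms by (simp add: add_assoc add_closed)
  finally show ?thesis .
qed

lemma norm_diff_commute: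
  assumes "x \<in> points V" "y \<in> points V"
  shows "normv V (diffv x y) = normv V (diffv y x)"
proof -
  have "scalev V (- 1) (diffv x y) = diffv y x"
    using assms by (simp add: scale_add_right scale_closed scale_scale scale_one add_commute)
  then show ?thesis
    using norm_scale[OF add_closed[OF assms(1) scale_closed[OF assms(2)]], of "- 1" "- 1"] by simp
qed

lemma norm_diff_triangle:
  assumes "x \<in> points V" "y \<in> points V" "z \<in> points V"
  shows "normv V (diffv x z) \<le> normv V (diffv x y) + normv V (diffv y z)"
proof -
  have "addv V (diffv x y) (diffv y z) = addv V (diffv x y) (addv V (scalev V (- 1) z) y)"
    using assms by (simp add: add_commute scale_closed)
  also have "\<dots> = addv V (diffv x z) (addv V (scalev V (- 1) y) y)"
    using assms by (intro add_swap_middle scale_closed)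
  also have "\<dots> = diffv x z"
    using assms
    by (simp add: add_commute[of _ y] diff_self add_commute[of _ "zerov V"] zero_closed add_zero
        add_closed scale_closed)
  finally show ?thesis
    using norm_triangle[of "diffv x y" "diffv y z"] assms by (simp add: add_closed scale_closed)
qed

lemma diff_combination:
  assumes "x \<in> points V" "y \<in> points V" "x' \<in> points V" "y' \<in> points V"
  shows "diffv (addv V (scalev V s x) (scalev V t y)) (addv V (scalev V s x') (scalev V t y')) =
    addv V (scalev V s (diffv x x')) (scalev V t (diffv y y'))"
  using assms add_swap_middle[of "scalev V s x" "scalev V t y" "scalev V (- s) x'" "scalev V (- t) y'"]
  by (simp add: scale_add_right scale_closed add_closed scale_scale)

end

text \<open>
  The distance between points of the two images inherits joint convexity and the triangle
  inequality from the norm; isometry turns distances within one image into state distances.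
\<close>

lemma bridge_of_embeddings:
  assumes A: "order_unit_space eA" "lip_norm eA LA" and B: "order_unit_space eB" "lip_norm eB LB"
    and V: "real_normed_space V"
    and hA: "affine_isometric_embedding eA LA V hA" and hB: "affine_isometric_embedding eB LB V hB"
  shows "bridge eA LA eB LB (\<lambda>\<mu> \<nu>. normv V (addv V (hA \<mu>) (scalev V (- 1) (hB \<nu>))))"
proof -
  interpret real_normed_space V by (rule V)
  have A_points: "hA \<mu> \<in> points V" if "\<mu> \<in> states eA" for \<mu>
    using hA that by (auto simp: affine_isometric_embedding_def)
  have B_points: "hB \<nu> \<in> points V" if "\<nu> \<in> states eB" for \<nu>
    using hB that by (auto simp: affine_isometric_embedding_def)
  have A_affine: "hA (mix t \<mu> \<mu>') = addv V (scalev V (1 - t) (hA \<mu>)) (scalev V t (hA \<mu>'))"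
    if "\<mu> \<in> states eA" "\<mu>' \<in> states eA" "t \<in> {0..1}" for \<mu> \<mu>' t
    using hA that by (simp add: affine_isometric_embedding_def)
  have B_affine: "hB (mix t \<nu> \<nu>') = addv V (scalev V (1 - t) (hB \<nu>)) (scalev V t (hB \<nu>'))"
    if "\<nu> \<in> states eB" "\<nu>' \<in> states eB" "t \<in> {0..1}" for \<nu> \<nu>' t
    using hB that by (simp add: affine_isometric_embedding_def)
  have A_dist: "normv V (diffv (hA \<mu>) (hA \<mu>')) = state_dist LA \<mu> \<mu>'"
    if "\<mu> \<in> states eA" "\<mu>' \<in> states eA" for \<mu> \<mu>'
  proof -
    have "ennreal (normv V (diffv (hA \<mu>) (hA \<mu>'))) = ennreal (state_dist LA \<mu> \<mu>')"
      using hA that rho_states[OF A that] by (simp add: affine_isometric_embedding_def distv_def)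
    then show ?thesis
      using that lip_dual_nonneg[OF lip_seminorm[OF A] state_diff_lip_bounded[OF A that]]
      by (simp add: norm_nonneg add_closed scale_closed A_points)
  qed
  have B_dist: "normv V (diffv (hB \<nu>) (hB \<nu>')) = state_dist LB \<nu> \<nu>'"
    if "\<nu> \<in> states eB" "\<nu>' \<in> states eB" for \<nu> \<nu>'
  proof -
    have "ennreal (normv V (diffv (hB \<nu>) (hB \<nu>'))) = ennreal (state_dist LB \<nu> \<nu>')"
      using hB that rho_states[OF B that] by (simp add: affine_isometric_embedding_def distv_def)
    then show ?thesis
      using that lip_dual_nonneg[OF lip_seminorm[OF B] state_diff_lip_bounded[OF B that]]
      by (simp add: norm_nonneg add_closed scale_closed B_points)
  qed
  show ?thesis
    unfolding bridge_def
  proof (intro conjI ballI)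
    fix \<mu> \<nu> assume "\<mu> \<in> states eA" "\<nu> \<in> states eB"
    then show "0 \<le> normv V (diffv (hA \<mu>) (hB \<nu>))"
      by (intro norm_nonneg add_closed scale_closed A_points B_points)
  next
    fix \<mu> \<mu>' \<nu> \<nu>' and t :: real
    assume st: "\<mu> \<in> states eA" "\<mu>' \<in> states eA" "\<nu> \<in> states eB" "\<nu>' \<in> states eB"
      and t: "t \<in> {0..1}"
    note pts = A_points[OF st(1)] A_points[OF st(2)] B_points[OF st(3)] B_points[OF st(4)]
    note diff_pts = add_closed[OF pts(1) scale_closed[OF pts(3), of "- 1"]]
      add_closed[OF pts(2) scale_closed[OF pts(4), of "- 1"]]
    have "diffv (hA (mix t \<mu> \<mu>')) (hB (mix t \<nu> \<nu>')) =
        addv V (scalev V (1 - t) (diffv (hA \<mu>) (hB \<nu>))) (scalev V t (diffv (hA \<mu>') (hB \<nu>')))"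
      unfolding A_affine[OF st(1,2) t] B_affine[OF st(3,4) t] by (rule diff_combination[OF pts])
    then show "normv V (diffv (hA (mix t \<mu> \<mu>')) (hB (mix t \<nu> \<nu>'))) \<le>
        (1 - t) * normv V (diffv (hA \<mu>) (hB \<nu>)) + t * normv V (diffv (hA \<mu>') (hB \<nu>'))"
      using norm_triangle[OF scale_closed[OF diff_pts(1), of "1 - t"] scale_closed[OF diff_pts(2), of t]]
        norm_scale[OF diff_pts(1), of "1 - t"] norm_scale[OF diff_pts(2), of t] t
      by simp
  next
    fix \<mu> \<mu>' \<nu> \<nu>'
    assume st: "\<mu> \<in> states eA" "\<mu>' \<in> states eA" "\<nu> \<in> states eB" "\<nu>' \<in> states eB"
    note pts = A_points[OF st(1)] A_points[OF st(2)] B_points[OF st(3)] B_points[OF st(4)]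
    note triangle = norm_diff_triangle
    note dist = A_dist[OF st(1,2)] B_dist[OF st(3,4)]
    note comm = norm_diff_commute[OF pts(4,2)] norm_diff_commute[OF pts(3,1)]
      norm_diff_commute[OF pts(2,1)]
    show "state_dist LA \<mu> \<mu>' \<le> normv V (diffv (hA \<mu>) (hB \<nu>)) + state_dist LB \<nu> \<nu>' +
        normv V (diffv (hA \<mu>') (hB \<nu>'))"
      using triangle[OF pts(1,3,2)] triangle[OF pts(3,4,2)] dist comm by linarith
    show "state_dist LB \<nu> \<nu>' \<le> normv V (diffv (hA \<mu>) (hB \<nu>)) + state_dist LA \<mu> \<mu>' +
        normv V (diffv (hA \<mu>') (hB \<nu>'))"
      using triangle[OF pts(3,1,4)] triangle[OF pts(1,2,4)] dist comm by linarith
    show "normv V (diffv (hA \<mu>') (hB \<nu>')) \<le> normv V (diffv (hA \<mu>) (hB \<nu>)) +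
        state_dist LA \<mu> \<mu>' + state_dist LB \<nu> \<nu>'"
      using triangle[OF pts(2,1,4)] triangle[OF pts(1,3,4)] dist comm by linarith
  qed
qed

section \<open>From admissible Lip-norms to embeddings\<close>

text \<open>
  The dual of the seminormed space given by \<open>L\<close>. Bounded functionals vanish on the kernel of \<open>L\<close>,
  so for a Lip-norm this space contains differences of states, but no state.
\<close>

definition dual_nspace :: "('c::real_vector \<Rightarrow> real) \<Rightarrow> ('v + ('c \<Rightarrow> real)) nspace" where
  "dual_nspace L = \<lparr>points = Inr ` {f. linear f \<and> lip_bounded L f}, zerov = Inr (\<lambda>_. 0),
     addv = (\<lambda>x y. Inr (\<lambda>c. projr x c + projr y c)), scalev = (\<lambda>r x. Inr (\<lambda>c. r * projr x c)),
     normv = (\<lambda>x. lip_dual L (projr x))\<rparr>"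

lemma lip_bounded_add:
  assumes "lip_bounded L f" "lip_bounded L g"
  shows "lip_bounded L (\<lambda>c. f c + g c)"
proof (rule lip_boundedI)
  fix c assume "L c \<le> 1"
  then show "\<bar>f c + g c\<bar> \<le> lip_dual L f + lip_dual L g"
    using lip_dual_upper[OF assms(1), of c] lip_dual_upper[OF assms(2), of c] by linarith
qed

lemma lip_dual_add:
  assumes L: "seminorm L" and "lip_bounded L f" "lip_bounded L g"
  shows "lip_dual L (\<lambda>c. f c + g c) \<le> lip_dual L f + lip_dual L g"
proof (rule lip_dual_least[OF L])
  fix c assume "L c \<le> 1"
  then show "\<bar>f c + g c\<bar> \<le> lip_dual L f + lip_dual L g"
    using lip_dual_upper[OF assms(2), of c] lip_dual_upper[OF assms(3), of c] by linarith
qed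

lemma lip_bounded_scale: "lip_bounded L f \<Longrightarrow> lip_bounded L (\<lambda>c. r * f c)"
  by (rule lip_boundedI[of _ _ "\<bar>r\<bar> * lip_dual L f"])
    (simp add: abs_mult mult_left_mono lip_dual_upper)

lemma lip_dual_scale_le:
  "seminorm L \<Longrightarrow> lip_bounded L f \<Longrightarrow> lip_dual L (\<lambda>c. r * f c) \<le> \<bar>r\<bar> * lip_dual L f"
  by (rule lip_dual_least) (simp_all add: abs_mult mult_left_mono lip_dual_upper)

lemma lip_dual_scale:
  assumes L: "seminorm L" and f: "lip_bounded L f"
  shows "lip_dual L (\<lambda>c. r * f c) = \<bar>r\<bar> * lip_dual L f"
proof (cases "r = 0")
  case True
  then show ?thesis
    using lip_dual_scale_le[OF L f, of r] lip_dual_nonneg[OF L lip_bounded_scale[OF f, of r]] by simp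
next
  case False
  have "lip_dual L (\<lambda>c. inverse r * (r * f c)) \<le> \<bar>inverse r\<bar> * lip_dual L (\<lambda>c. r * f c)"
    by (rule lip_dual_scale_le[OF L lip_bounded_scale[OF f]])
  also have "(\<lambda>c. inverse r * (r * f c)) = f" using False by (simp add: fun_eq_iff)
  finally have "\<bar>r\<bar> * lip_dual L f \<le> lip_dual L (\<lambda>c. r * f c)"
    using False by (simp add: field_simps)
  then show ?thesis using lip_dual_scale_le[OF L f, of r] by simp
qed

lemma real_normed_space_dual_nspace:
  fixes L :: "'c::real_vector \<Rightarrow> real"
  assumes L: "seminorm L"
  shows "real_normed_space (dual_nspace L :: ('v + ('c \<Rightarrow> real)) nspace)"
proof
  let ?V = "dual_nspace L :: ('v + ('c \<Rightarrow> real)) nspace"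
  have pts: "x \<in> points ?V \<longleftrightarrow> (\<exists>f. x = Inr f \<and> linear f \<and> lip_bounded L f)" for x
    by (auto simp: dual_nspace_def)
  note ops = dual_nspace_def
  show "zerov ?V \<in> points ?V"
    by (auto simp: pts) (auto simp: ops linear_iff intro: lip_boundedI[of _ _ 0])
  fix x assume "x \<in> points ?V"
  then obtain f where x: "x = Inr f" and f: "linear f" "lip_bounded L f" by (auto simp: pts)
  have scale_points: "scalev ?V r x \<in> points ?V" for r
    using f by (auto simp: pts ops x linear_iff lip_bounded_scale algebra_simps)
  then show "scalev ?V r x \<in> points ?V" for r .
  show "addv ?V (zerov ?V) x = x" by (simp add: ops x)
  have "addv ?V (scalev ?V (- 1) x) x = zerov ?V" by (simp add: ops x)
  then show "\<exists>y\<in>points ?V. addv ?V y x = zerov ?V" using scale_points by blast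
  show "scalev ?V (r + s) x = addv ?V (scalev ?V r x) (scalev ?V s x)" for r s
    by (simp add: ops x algebra_simps)
  show "scalev ?V r (scalev ?V s x) = scalev ?V (r * s) x" for r s
    by (simp add: ops x mult.assoc)
  show "scalev ?V 1 x = x" by (simp add: ops x)
  show "0 \<le> normv ?V x" by (simp add: ops x lip_dual_nonneg[OF L f(2)])
  have "f = (\<lambda>_. 0)" if "lip_dual L f = 0"
    using lip_dual_bound[OF L f] that by (simp add: fun_eq_iff)
  moreover have "lip_dual L (\<lambda>_. 0) = 0"
    using lip_dual_scale[OF L f(2), of 0] by simp
  ultimately show "normv ?V x = 0 \<longleftrightarrow> x = zerov ?V" by (auto simp: ops x)
  show "normv ?V (scalev ?V r x) = \<bar>r\<bar> * normv ?V x" for r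
    by (simp add: ops x lip_dual_scale[OF L f(2)])
  fix y assume "y \<in> points ?V"
  then obtain g where y: "y = Inr g" and g: "linear g" "lip_bounded L g" by (auto simp: pts)
  show "addv ?V x y \<in> points ?V"
    using f g by (auto simp: pts ops x y linear_iff lip_bounded_add algebra_simps)
  show "addv ?V x y = addv ?V y x" by (simp add: ops x y add.commute)
  show "scalev ?V r (addv ?V x y) = addv ?V (scalev ?V r x) (scalev ?V r y)" for r
    by (simp add: ops x y algebra_simps)
  show "normv ?V (addv ?V x y) \<le> normv ?V x + normv ?V y"
    by (simp add: ops x y lip_dual_add[OF L f(2) g(2)])
  fix z assume "z \<in> points ?V"
  show "addv ?V (addv ?V x y) z = addv ?V x (addv ?V y z)" by (simp add: ops add.assoc)
qed

text \<open>
  The unit ball of a quotient seminorm is the image of the unit ball up to a factor arbitrarily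
  close to \<open>1\<close>; the factor is there because the infimum need not be attained.
\<close>

lemma rho_quotient_seminorm:
  assumes L: "seminorm L" and p: "linear p" "surj p" and \<mu>: "linear \<mu>" and \<nu>: "linear \<nu>"
  shows "rho L (\<mu> \<circ> p) (\<nu> \<circ> p) = rho (quotient_seminorm p L) \<mu> \<nu>"
proof (rule antisym)
  have "quotient_seminorm p L (p c) \<le> L c" for c
    unfolding quotient_seminorm_def
    by (rule cInf_lower) (auto intro: bdd_belowI[of _ 0] seminorm_nonneg[OF L])
  then show "rho L (\<mu> \<circ> p) (\<nu> \<circ> p) \<le> rho (quotient_seminorm p L) \<mu> \<nu>"
    unfolding rho_def by (intro SUP_mono) (force intro: order_trans)
  show "rho (quotient_seminorm p L) \<mu> \<nu> \<le> rho L (\<mu> \<circ> p) (\<nu> \<circ> p)"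
  proof (cases "rho L (\<mu> \<circ> p) (\<nu> \<circ> p)")
    case (real r)
    then have r: "\<bar>\<mu> (p c) - \<nu> (p c)\<bar> \<le> r" if "L c \<le> 1" for c
      using rho_le_iff[of r L "\<mu> \<circ> p" "\<nu> \<circ> p"] that by simp
    have "\<bar>\<mu> a - \<nu> a\<bar> \<le> r" if a: "quotient_seminorm p L a \<le> 1" for a
    proof (rule field_le_mult_one_interval)
      fix \<theta> :: real assume \<theta>: "0 < \<theta>" "\<theta> < 1"
      then have "1 < 1 / \<theta>" by simp
      then have less: "Inf {L c |c. p c = a} < 1 / \<theta>"
        using a unfolding quotient_seminorm_def by linarith
      obtain c\<^sub>0 where "p c\<^sub>0 = a" using p(2) by (metis surjD)
      then have "{L c |c. p c = a} \<noteq> {}" by blast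
      from cInf_lessD[OF this less] obtain c where c: "p c = a" "L c < 1 / \<theta>" by blast
      have "L (\<theta> *\<^sub>R c) \<le> 1" using c(2) \<theta> by (simp add: seminorm_scale[OF L] field_simps)
      from r[OF this] have "\<bar>\<theta> * (\<mu> a - \<nu> a)\<bar> \<le> r"
        by (simp add: linear_cmul[OF p(1)] linear_cmul[OF \<mu>] linear_cmul[OF \<nu>] c(1) right_diff_distrib)
      then show "\<theta> * \<bar>\<mu> a - \<nu> a\<bar> \<le> r" using \<theta> by (simp add: abs_mult)
    qed
    then show ?thesis using real by (simp add: rho_le_iff)
  qed simp
qed

text \<open>The base point \<open>\<omega>\<close> moves the affine space of states into the linear space.\<close>

definition state_embedding :: "('c \<Rightarrow> real) \<Rightarrow> ('c \<Rightarrow> real) \<Rightarrow> 'v + ('c \<Rightarrow> real)" where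
  "state_embedding \<omega> \<kappa> = Inr (\<lambda>c. \<kappa> c - \<omega> c)"

context
  fixes e :: "'c::ordered_real_vector" and L \<omega>
  assumes C: "order_unit_space e" "lip_norm e L" and \<omega>: "\<omega> \<in> states e"
begin

lemma state_embedding_points:
  "\<kappa> \<in> states e \<Longrightarrow> state_embedding \<omega> \<kappa> \<in> points (dual_nspace L)"
  using state_diff_lip_bounded[OF C _ \<omega>] state_linear[OF C(1)] \<omega>
  by (simp add: state_embedding_def dual_nspace_def linear_compose_sub)

lemma distv_state_embedding:
  assumes "\<kappa> \<in> states e" "\<kappa>' \<in> states e"
  shows "distv (dual_nspace L :: ('v + ('c \<Rightarrow> real)) nspace)
    (state_embedding \<omega> \<kappa>) (state_embedding \<omega> \<kappa>') = rho L \<kappa> \<kappa>'"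
  by (simp add: distv_def dual_nspace_def state_embedding_def rho_states[OF C assms])

lemma affine_isometric_embedding_quotient:
  fixes e' :: "'a::ordered_real_vector"
  assumes A: "order_unit_space e'" and p: "linear p" "surj p"
    and st: "\<And>\<mu>. \<mu> \<in> states e' \<Longrightarrow> \<mu> \<circ> p \<in> states e"
  shows "affine_isometric_embedding e' (quotient_seminorm p L)
    (dual_nspace L :: ('v + ('c \<Rightarrow> real)) nspace) (\<lambda>\<mu>. state_embedding \<omega> (\<mu> \<circ> p))"
  unfolding affine_isometric_embedding_def
proof (intro conjI ballI)
  show "(\<lambda>\<mu>. state_embedding \<omega> (\<mu> \<circ> p)) ` states e' \<subseteq>
      points (dual_nspace L :: ('v + ('c \<Rightarrow> real)) nspace)"
    using st by (auto intro: state_embedding_points)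
next
  fix \<mu> \<nu> assume "\<mu> \<in> states e'" "\<nu> \<in> states e'"
  then show "distv (dual_nspace L :: ('v + ('c \<Rightarrow> real)) nspace)
      (state_embedding \<omega> (\<mu> \<circ> p)) (state_embedding \<omega> (\<nu> \<circ> p)) = rho (quotient_seminorm p L) \<mu> \<nu>"
    by (simp add: distv_state_embedding st
        rho_quotient_seminorm[OF lip_seminorm[OF C] p state_linear[OF A] state_linear[OF A]])
qed (simp add: dual_nspace_def state_embedding_def algebra_simps)

end

section \<open>The quantum distance as a distance of embedded state spaces\<close>

theorem proposition3p2:
  fixes eA :: "'a::ordered_real_vector" and LA :: "'a \<Rightarrow> real"
    and eB :: "'b::ordered_real_vector" and LB :: "'b \<Rightarrow> real"
  assumes "compact_quantum_metric_space eA LA"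
    and "compact_quantum_metric_space eB LB"
  shows "dist_q eA LA eB LB = Inf (embedding_dists TYPE('v) eA LA eB LB)"
proof (rule antisym)
  have A: "order_unit_space eA" "lip_norm eA LA" and B: "order_unit_space eB" "lip_norm eB LB"
    using assms by (simp_all add: compact_quantum_metric_space_def)
  show "dist_q eA LA eB LB \<le> Inf (embedding_dists TYPE('v) eA LA eB LB)"
  proof (rule Inf_greatest)
    fix d assume "d \<in> embedding_dists TYPE('v) eA LA eB LB"
    then obtain V :: "('v + ('a \<times> 'b \<Rightarrow> real)) nspace" and hA hB
      where d: "d = hausdorff_dist (distv V) (hA ` states eA) (hB ` states eB)"
        and V: "real_normed_space V" and hA: "affine_isometric_embedding eA LA V hA"
        and hB: "affine_isometric_embedding eB LB V hB"
      unfolding embedding_dists_def by blast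
    show "dist_q eA LA eB LB \<le> d"
      using dist_q_le_bridge[OF A B bridge_of_embeddings[OF A B V hA hB]]
      by (simp add: d hausdorff_dist_def distv_def image_image)
  qed
  show "Inf (embedding_dists TYPE('v) eA LA eB LB) \<le> dist_q eA LA eB LB"
    unfolding dist_q_def
  proof (rule Inf_greatest)
    fix d
    assume "d \<in> {hausdorff_dist (rho L) ((\<lambda>\<mu>. \<mu> \<circ> fst) ` states eA) ((\<lambda>\<nu>. \<nu> \<circ> snd) ` states eB) |L.
      admissible eA LA eB LB L}"
    then obtain L where
      d: "d = hausdorff_dist (rho L) ((\<lambda>\<mu>. \<mu> \<circ> fst) ` states eA) ((\<lambda>\<nu>. \<nu> \<circ> snd) ` states eB)"
      and L: "lip_norm (eA, eB) L" and LA: "quotient_seminorm fst L = LA"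
      and LB: "quotient_seminorm snd L = LB"
      by (auto simp: admissible_def)
    note AB = order_unit_space_Pair[OF A(1) B(1)]
    note fst = state_comp_fst[OF A(1) B(1)] and snd = state_comp_snd[OF A(1) B(1)]
    obtain \<omega> where \<omega>: "\<omega> \<in> states (eA, eB)" using states_nonempty[OF AB] by blast
    let ?V = "dual_nspace L :: ('v + ('a \<times> 'b \<Rightarrow> real)) nspace"
    let ?hA = "\<lambda>\<mu>. state_embedding \<omega> (\<mu> \<circ> fst) :: 'v + ('a \<times> 'b \<Rightarrow> real)"
    let ?hB = "\<lambda>\<nu>. state_embedding \<omega> (\<nu> \<circ> snd) :: 'v + ('a \<times> 'b \<Rightarrow> real)"
    have "affine_isometric_embedding eA LA ?V ?hA" "affine_isometric_embedding eB LB ?V ?hB"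
      using affine_isometric_embedding_quotient[OF AB L \<omega> A(1) linear_fst range_fst fst]
        affine_isometric_embedding_quotient[OF AB L \<omega> B(1) linear_snd range_snd snd]
      by (simp_all add: LA LB)
    then have "hausdorff_dist (distv ?V) (?hA ` states eA) (?hB ` states eB) \<in>
        embedding_dists TYPE('v) eA LA eB LB"
      unfolding embedding_dists_def
      using real_normed_space_dual_nspace[OF lip_seminorm[OF AB L]] by blast
    moreover have "hausdorff_dist (distv ?V) (?hA ` states eA) (?hB ` states eB) = d"
      unfolding d hausdorff_dist_def image_image
      by (intro arg_cong2[of _ _ _ _ max] SUP_cong INF_cong refl distv_state_embedding[OF AB L \<omega>]
          fst snd)
    ultimately show "Inf (embedding_dists TYPE('v) eA LA eB LB) \<le> d"
      by (auto dest: Inf_lower)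
  qed
qed

end
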